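(* For $|q|<1$ the following two identities hold: $$\sum_{i,j,k\geq 0} \frac{\left(1+q^{2i+4j+6k+2}-q^{3i+6j+9k+5}\right)q^{\binom{i+2j+3k}{2}+i+j^2+2j+2k}}{(q;q)_i(q^2;q^2)_j(q^3;q^3)_k}=\frac{1}{(q^2;q^3)_\infty(q,q^6,q^9;q^{12})_\infty},$$ $$\sum_{i,j,k\geq 0} \frac{\left(1+q+q^{2j+3k+2}\right)q^{\binom{i+2j+3k}{2}+3i+j^2+4j+7k}}{(q;q)_i(q^2;q^2)_j(q^3;q^3)_k}=\frac{1}{(q;q^3)_\infty(q^5,q^6,q^9;q^{12})_\infty}.$$
   Context: Here $q$ is a complex number with $|q|<1$. For a base $p$ with $|p|<1$: $(a;p)_\infty=\prod_{k\ge 0}(1-ap^k)$, $(a;p)_n=\prod_{k=0}^{n-1}(1-ap^k)$ for integers $n\ge 0$, and $(a_1,\dots,a_m;p)_n=(a_1;p)_n\cdots(a_m;p)_n$ for $n\in\mathbb{Z}_{\ge0}\cup\{\infty\}$. Also $\binom{N}{2}=N(N-1)/2$. *)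

theory Defs
  imports "HOL-Analysis.Analysis"
begin

definition qpoch :: "complex \<Rightarrow> complex \<Rightarrow> nat \<Rightarrow> complex" where
  "qpoch a p n = (\<Prod>k<n. 1 - a * p ^ k)"

text \<open>
  The infinite product converges whenever \<open>norm p < 1\<close>, also when some factor is zero;
  its value for other \<open>p\<close> is not meaningful.
\<close>
definition qpoch_inf :: "complex \<Rightarrow> complex \<Rightarrow> complex" where
  "qpoch_inf a p = (\<Prod>k. 1 - a * p ^ k)"

end

theory Submission
  imports Defs
begin

text \<open>
  Euler's expansion of \<open>(-z; q)\<^sub>\<infinity>\<close> carries out the sum over \<open>i\<close>. What remains is \<open>(-q; q)\<^sub>\<infinity>\<close> times a
  double series over \<open>j\<close> and \<open>k\<close>, whose part \<open>c\<^sub>n\<close> with \<open>j + k = n\<close> satisfies a recurrence of order two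
  in \<open>n\<close> with coefficients polynomial in \<open>q\<^sup>6\<^sup>n\<close> (creative telescoping). The generating function of
  a solution is, with \<open>Q = q\<^sup>6\<close>, an infinite product times a \<open>\<^sub>2\<phi>\<^sub>1\<close> with base \<open>Q\<close>, which at the argument needed
  is summed by the Bailey--Daum theorem. In the first identity the double series is first
  replaced by another one with the same total, whose \<open>c\<^sub>n\<close> satisfy such a recurrence.
\<close>

section \<open>The q-binomial theorem\<close>

text \<open>The weights 2 and 3 of \<open>j\<close> and \<open>k\<close> are reconciled by
  \<open>(q^(2*j))^3 * (q^(3*k))^2 = q^(6*(j+k))\<close>, which depends on \<open>j + k\<close>
  alone; hence the diagonals and the base \<open>Q = q^6\<close>. In the recurrence,
  \<open>r\<close> is read off from the leading coefficient
  \<open>(1 - Q^(n+1)) * (1 - r * Q^(n+1))\<close>, while \<open>b\<close> and \<alpha> come from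
  the sum \<open>b + \<alpha>\<close> together with \<open>b * \<alpha> = Q\<close>. The triples (r,
  b, \<alpha>) are (q^2, 1/q, q^7) for the first identity and (q^4, q, q^5) for the second. The
  total of the diagonal sums is the generating function at z = 1; there the 2phi1 with parameters
  \<open>r * b\<close>, \<open>b\<close> over \<open>r * Q\<close> has argument -\<alpha> = -Q/b,
  which is exactly the Bailey-Daum argument. That theorem yields products to the bases q^6 and q^12,
  so the final comparison sorts factors by residues modulo 12. Because 1/q occurs as a parameter,
  the value q = 0 is treated apart in the first identity.\<close>

lemma qpoch_0 [simp]: "qpoch a p 0 = 1"
  by (simp add: qpoch_def)

lemma qpoch_Suc: "qpoch a p (Suc n) = qpoch a p n * (1 - a * p ^ n)"
  by (simp add: qpoch_def)

lemma qpoch_add: "qpoch a p (m + n) = qpoch a p m * qpoch (a * p ^ m) p n"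
  by (induction n) (simp_all add: qpoch_Suc power_add mult.assoc)

lemma qpoch_mult_minus: "qpoch a p n * qpoch (- a) p n = qpoch (a\<^sup>2) (p\<^sup>2) n"
  by (induction n) (simp_all add: qpoch_Suc power2_eq_square power_mult_distrib algebra_simps)

lemma one_minus_nonzero: "norm (z::complex) < 1 \<Longrightarrow> 1 - z \<noteq> 0"
  by auto

lemma norm_mult_power_lt_1:
  fixes a p :: complex
  assumes "norm a < 1" "norm p < 1"
  shows "norm (a * p ^ n) < 1"
proof -
  have "norm (a * p ^ n) \<le> norm a * 1"
    unfolding norm_mult norm_power by (intro mult_left_mono power_le_one) (use assms in auto)
  with assms show ?thesis by simp
qed

lemma norm_power_Suc_lt_1: "norm (p::complex) < 1 \<Longrightarrow> norm (p ^ Suc n) < 1"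
  using norm_mult_power_lt_1[of p p n] by simp

lemma norm_power_pos_lt_1: "norm (p::complex) < 1 \<Longrightarrow> 0 < n \<Longrightarrow> norm (p ^ n) < 1"
  using norm_power_Suc_lt_1[of p "n - 1"] by simp

lemma qpoch_nonzero: "norm a < 1 \<Longrightarrow> norm p < 1 \<Longrightarrow> qpoch a p n \<noteq> 0"
  unfolding qpoch_def
  by (simp del: right_minus_eq add: one_minus_nonzero norm_mult_power_lt_1)

lemma convergent_prod_qpoch:
  fixes a p :: complex
  assumes "norm p < 1"
  shows "convergent_prod (\<lambda>k. 1 - a * p ^ k)"
proof (rule abs_convergent_prod_imp_convergent_prod, rule summable_imp_abs_convergent_prod)
  have "summable (\<lambda>k. norm a * norm p ^ k)"
    by (intro summable_mult summable_geometric) (use assms in auto)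
  thus "summable (\<lambda>k. norm (1 - a * p ^ k - 1))"
    by (simp add: norm_mult norm_power)
qed

lemma qpoch_tendsto:
  assumes "norm p < 1"
  shows "qpoch a p \<longlonglongrightarrow> qpoch_inf a p"
proof -
  have "(\<lambda>n. qpoch a p (Suc n)) \<longlonglongrightarrow> qpoch_inf a p"
    using convergent_prod_LIMSEQ[OF convergent_prod_qpoch[OF assms, of a]]
    by (simp add: qpoch_def qpoch_inf_def lessThan_Suc_atMost)
  thus ?thesis by (rule LIMSEQ_imp_Suc)
qed

lemma qpoch_inf_eqI:
  assumes "norm p < 1" "qpoch a p \<longlonglongrightarrow> L"
  shows "qpoch_inf a p = L"
  using LIMSEQ_unique qpoch_tendsto assms by blast

lemma qpoch_inf_nonzero:
  assumes "norm a < 1" "norm p < 1"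
  shows "qpoch_inf a p \<noteq> 0"
  unfolding qpoch_inf_def
  by (rule prodinf_nonzero) (simp_all del: right_minus_eq
    add: convergent_prod_qpoch assms one_minus_nonzero norm_mult_power_lt_1)

section \<open>Splitting and dissecting infinite products\<close>

lemma qpoch_inf_split:
  assumes "norm p < 1"
  shows "qpoch_inf a p = qpoch a p n * qpoch_inf (a * p ^ n) p"
proof (rule qpoch_inf_eqI[OF assms])
  have "(\<lambda>m. qpoch a p n * qpoch (a * p ^ n) p m) \<longlonglongrightarrow> qpoch a p n * qpoch_inf (a * p ^ n) p"
    by (intro tendsto_intros qpoch_tendsto assms)
  hence "(\<lambda>m. qpoch a p (m + n)) \<longlonglongrightarrow> qpoch a p n * qpoch_inf (a * p ^ n) p"
    by (simp add: qpoch_add[symmetric] add.commute)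
  thus "qpoch a p \<longlonglongrightarrow> qpoch a p n * qpoch_inf (a * p ^ n) p"
    by (rule LIMSEQ_offset)
qed

lemma qpoch_inf_head:
  assumes "norm p < 1"
  shows "qpoch_inf a p = (1 - a) * qpoch_inf (a * p) p"
  using qpoch_inf_split[OF assms, of a 1] by (simp add: qpoch_Suc)

lemma qpoch_inf_mult_minus:
  assumes "norm p < 1"
  shows "qpoch_inf a p * qpoch_inf (- a) p = qpoch_inf (a\<^sup>2) (p\<^sup>2)"
proof (rule qpoch_inf_eqI[symmetric])
  show "norm (p\<^sup>2) < 1" using assms by (rule norm_power_pos_lt_1) simp
  show "qpoch (a\<^sup>2) (p\<^sup>2) \<longlonglongrightarrow> qpoch_inf a p * qpoch_inf (- a) p"
    unfolding qpoch_mult_minus[symmetric]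
    by (intro tendsto_intros qpoch_tendsto assms)
qed

text \<open>The factors are sorted by the residue \<open>r\<close> of their exponent modulo
  \<open>m\<close>; each class is a product to the base \<open>p ^ m\<close>.\<close>

lemma qpoch_mult_dissect: "qpoch a p (m * n) = (\<Prod>r<m. qpoch (a * p ^ r) (p ^ m) n)"
proof (induction n)
  case (Suc n)
  have "qpoch a p (m * Suc n) = qpoch a p (m * n) * qpoch (a * p ^ (m * n)) p m"
    by (simp add: qpoch_add[symmetric] add.commute)
  also have "\<dots> = (\<Prod>r<m. qpoch (a * p ^ r) (p ^ m) n * (1 - a * p ^ r * (p ^ m) ^ n))"
    unfolding Suc prod.distrib
    by (simp add: qpoch_def power_mult[symmetric] mult_ac power_add)
  finally show ?case by (simp add: qpoch_Suc)
qed simp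

lemma qpoch_inf_dissect:
  assumes "norm p < 1" "0 < m"
  shows "qpoch_inf a p = (\<Prod>r<m. qpoch_inf (a * p ^ r) (p ^ m))"
proof -
  have "strict_mono ((*) m)" using assms by (auto intro!: strict_monoI)
  hence "(\<lambda>n. qpoch a p (m * n)) \<longlonglongrightarrow> qpoch_inf a p"
    using LIMSEQ_subseq_LIMSEQ[OF qpoch_tendsto[OF assms(1)], of "(*) m"] by (simp add: o_def)
  moreover have "(\<lambda>n. qpoch a p (m * n)) \<longlonglongrightarrow> (\<Prod>r<m. qpoch_inf (a * p ^ r) (p ^ m))"
    unfolding qpoch_mult_dissect
    by (intro tendsto_prod qpoch_tendsto norm_power_pos_lt_1 assms)
  ultimately show ?thesis by (rule LIMSEQ_unique)
qed

lemma qpoch_inf_even_odd: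
  assumes "norm p < 1"
  shows "qpoch_inf a p = qpoch_inf a (p\<^sup>2) * qpoch_inf (a * p) (p\<^sup>2)"
  using qpoch_inf_dissect[OF assms, of 2 a] by (simp add: lessThan_Suc numeral_2_eq_2)

text \<open>Euler's theorem on distinct and odd parts: \<open>(p; p)\<close> times
  \<open>(-p; p)\<close> is \<open>(p^2; p^2)\<close>, and \<open>(p; p)\<close> itself is
  \<open>(p; p^2)\<close> times \<open>(p^2; p^2)\<close>, so the nonzero even part cancels.\<close>

lemma qpoch_inf_minus_mult_odd:
  assumes "norm p < 1"
  shows "qpoch_inf (- p) p * qpoch_inf p (p\<^sup>2) = 1"
proof -
  have p2: "norm (p\<^sup>2) < 1" using assms by (rule norm_power_pos_lt_1) simp
  have "(qpoch_inf (- p) p * qpoch_inf p (p\<^sup>2)) * qpoch_inf (p\<^sup>2) (p\<^sup>2)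
      = qpoch_inf p p * qpoch_inf (- p) p"
    using qpoch_inf_even_odd[OF assms, of p] by (simp add: power2_eq_square mult_ac)
  also have "\<dots> = 1 * qpoch_inf (p\<^sup>2) (p\<^sup>2)"
    using qpoch_inf_mult_minus[OF assms] by simp
  finally show ?thesis
    using qpoch_inf_nonzero[OF p2 p2] by simp
qed

text \<open>A homogeneous form of \<open>(A; p)_n / (p; p)_n\<close>: the extra parameter
  \<open>s\<close> reaches the confluent case \<open>s = 0\<close> without a limit, so one proof
  covers both series.\<close>

definition qbinom_coeff :: "complex \<Rightarrow> complex \<Rightarrow> complex \<Rightarrow> nat \<Rightarrow> complex" where
  "qbinom_coeff s A p n = (\<Prod>k<n. (s - A * p ^ k) / (1 - p ^ Suc k))"

lemma qbinom_coeff_0 [simp]: "qbinom_coeff s A p 0 = 1"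
  by (simp add: qbinom_coeff_def)

lemma qbinom_coeff_Suc:
  assumes "norm p < 1"
  shows "(1 - p ^ Suc n) * qbinom_coeff s A p (Suc n) = (s - A * p ^ n) * qbinom_coeff s A p n"
  using one_minus_nonzero[OF norm_power_Suc_lt_1[OF assms, of n]] by (simp add: qbinom_coeff_def)

lemma qbinom_coeff_1:
  "qbinom_coeff 1 A p n = qpoch A p n / qpoch p p n"
  by (simp add: qbinom_coeff_def qpoch_def prod_dividef)

lemma qbinom_coeff_euler:
  "qbinom_coeff 0 (- A) p n = A ^ n * p ^ (n choose 2) / qpoch p p n"
proof (induction n)
  case (Suc n)
  have *: "qbinom_coeff s A p (Suc n) = qbinom_coeff s A p n * ((s - A * p ^ n) / (1 - p ^ Suc n))"
    for s A by (simp add: qbinom_coeff_def)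
  have "Suc n choose 2 = n + (n choose 2)"
    by (simp add: numeral_2_eq_2)
  thus ?case by (simp add: Suc * qpoch_Suc power_add)
qed (simp add: numeral_2_eq_2)

lemma summable_norm_of_ratio:
  fixes f :: "nat \<Rightarrow> complex"
  assumes "\<And>n. f (Suc n) = g n * f n" "g \<longlonglongrightarrow> L" "norm L < 1"
  shows "summable (\<lambda>n. norm (f n))"
proof -
  obtain c where c: "norm L < c" "c < 1" using assms(3) dense by blast
  have "(\<lambda>n. norm (g n)) \<longlonglongrightarrow> norm L" by (intro tendsto_intros assms)
  hence "eventually (\<lambda>n. norm (g n) < c) sequentially" using c(1) by (rule order_tendstoD)
  then obtain N where N: "\<And>n. n \<ge> N \<Longrightarrow> norm (g n) < c" by (auto simp: eventually_sequentially)
  show ?thesis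
  proof (rule summable_ratio_test[OF c(2)])
    fix n assume "n \<ge> N"
    from N[OF this] show "norm (norm (f (Suc n))) \<le> c * norm (norm (f n))"
      by (simp add: assms(1) norm_mult mult_right_mono)
  qed
qed

lemma power_tendsto_0: "norm (p::complex) < 1 \<Longrightarrow> (\<lambda>n. p ^ n) \<longlonglongrightarrow> 0"
  by (rule LIMSEQ_power_zero)

lemma summable_qbinom:
  assumes "norm p < 1" "norm s \<le> 1" "norm z < 1"
  shows "summable (\<lambda>n. norm (qbinom_coeff s A p n * z ^ n))"
proof (rule summable_norm_of_ratio)
  have "(\<lambda>n. (s - A * p ^ n) / (1 - p * p ^ n) * z) \<longlonglongrightarrow> (s - A * 0) / (1 - p * 0) * z"
    by (intro tendsto_intros power_tendsto_0 assms) simp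
  thus "(\<lambda>n. (s - A * p ^ n) / (1 - p ^ Suc n) * z) \<longlonglongrightarrow> s * z" by simp
  have "norm s * norm z \<le> 1 * norm z" using assms by (intro mult_right_mono) auto
  thus "norm (s * z) < 1" using assms by (simp add: norm_mult)
qed (simp add: qbinom_coeff_def)

text \<open>
  For \<open>s = 1\<close> this is the \<open>q\<close>-binomial theorem, for \<open>s = 0\<close> Euler's expansion of \<open>(A z; p)\<^sub>\<infinity>\<close>.
  The sum \<open>F\<close> satisfies \<open>(1 - s z) F(z) = (1 - A z) F(p z)\<close>, which is iterated towards \<open>F(0) = 1\<close>.
\<close>
lemma qbinom_sums:
  assumes p: "norm p < 1" and s: "norm s \<le> 1" and z: "norm z < 1"
  shows "(\<lambda>n. qbinom_coeff s A p n * z ^ n) sums (qpoch_inf (A * z) p / qpoch_inf (s * z) p)"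
proof -
  define a where "a = qbinom_coeff s A p"
  define F where "F = (\<lambda>z. \<Sum>n. a n * z ^ n)"
  have sums: "(\<lambda>n. a n * z ^ n) sums F z" if "norm z < 1" for z
    using summable_qbinom[OF p s that, of A] 
    by (auto simp: F_def a_def dest: summable_norm_cancel)
  have fe: "(1 - s * z) * F z = (1 - A * z) * F (p * z)" if z: "norm z < 1" for z
  proof -
    have pz: "norm (p * z) < 1"
      using norm_mult_power_lt_1[OF z p, of 1] by (simp add: mult.commute)
    have 1: "(\<lambda>n. a n * z ^ n - a n * (p * z) ^ n) sums (F z - F (p * z))"
      by (intro sums_diff sums z pz)
    have "(\<lambda>n. a (Suc n) * z ^ Suc n - a (Suc n) * (p * z) ^ Suc n) sums (F z - F (p * z))"
      using 1 by (subst sums_Suc_iff) simp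
    moreover have "(\<lambda>n. s * z * (a n * z ^ n) - A * z * (a n * (p * z) ^ n))
        sums (s * z * F z - A * z * F (p * z))"
      by (intro sums_diff sums_mult sums z pz)
    moreover have "a (Suc n) * z ^ Suc n - a (Suc n) * (p * z) ^ Suc n
        = s * z * (a n * z ^ n) - A * z * (a n * (p * z) ^ n)" for n
    proof -
      have "a (Suc n) * z ^ Suc n - a (Suc n) * (p * z) ^ Suc n
          = ((1 - p ^ Suc n) * a (Suc n)) * z ^ Suc n"
        by (simp add: power_mult_distrib algebra_simps)
      also have "\<dots> = (s - A * p ^ n) * a n * z ^ Suc n"
        unfolding a_def qbinom_coeff_Suc[OF p] ..
      finally show ?thesis by (simp add: power_mult_distrib algebra_simps)
    qed
    ultimately have "F z - F (p * z) = s * z * F z - A * z * F (p * z)"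
      by (simp add: sums_iff)
    thus ?thesis by (simp add: algebra_simps)
  qed
  have iter: "qpoch (s * z) p n * F z = qpoch (A * z) p n * F (z * p ^ n)" for n
  proof (induction n)
    case (Suc n)
    have "norm (z * p ^ n) < 1" by (rule norm_mult_power_lt_1[OF z p])
    from fe[OF this] Suc show ?case
      by (simp add: qpoch_Suc mult_ac) (metis (no_types, lifting) mult.assoc mult.left_commute)
  qed simp
  \<comment> \<open>Convergence at \<open>1/2\<close>, an arbitrary nonzero point of the unit disc,
    makes the power series continuous at 0.\<close>
  have "isCont F 0"
    unfolding F_def
    by (rule isCont_powser[of a "1/2"])
       (use sums[of "1/2"] in \<open>auto simp: sums_iff\<close>)
  moreover have "(\<lambda>n. z * p ^ n) \<longlonglongrightarrow> z * 0"
    by (intro tendsto_intros power_tendsto_0 p)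
  ultimately have "(\<lambda>n. F (z * p ^ n)) \<longlonglongrightarrow> F 0"
    by (auto intro: isCont_tendsto_compose)
  moreover have "F 0 = 1"
    using powser_zero[of a] by (simp add: F_def a_def)
  ultimately have "(\<lambda>n. qpoch (A * z) p n * F (z * p ^ n)) \<longlonglongrightarrow> qpoch_inf (A * z) p * 1"
    by (intro tendsto_intros qpoch_tendsto p) auto
  moreover have "(\<lambda>n. qpoch (s * z) p n * F z) \<longlonglongrightarrow> qpoch_inf (s * z) p * F z"
    by (intro tendsto_intros qpoch_tendsto p)
  ultimately have "qpoch_inf (s * z) p * F z = qpoch_inf (A * z) p"
    unfolding iter using LIMSEQ_unique by fastforce
  moreover have "norm (s * z) < 1"
    using mult_right_mono[OF s, of "norm z"] z by (simp add: norm_mult)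
  ultimately have "F z = qpoch_inf (A * z) p / qpoch_inf (s * z) p"
    using qpoch_inf_nonzero[OF _ p] by (simp add: field_simps)
  with sums[OF z] show ?thesis by (simp add: a_def)
qed

lemma qbinom_theorem:
  assumes "norm p < 1" "norm z < 1"
  shows "(\<lambda>n. qpoch A p n / qpoch p p n * z ^ n) sums (qpoch_inf (A * z) p / qpoch_inf z p)"
  using qbinom_sums[OF assms(1) _ assms(2), of 1 A] by (simp add: qbinom_coeff_1)

lemma qpoch_inf_0 [simp]: "qpoch_inf 0 p = 1"
  by (simp add: qpoch_inf_def)

lemma euler_sums:
  assumes "norm p < 1" "norm z < 1"
  shows "(\<lambda>n. p ^ (n choose 2) * z ^ n / qpoch p p n) sums qpoch_inf (- z) p"
  using qbinom_sums[OF assms(1) _ assms(2), of 0 "- 1"] qbinom_coeff_euler[of 1 p]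
  by simp

section \<open>The Bailey--Daum summation\<close>

lemma summable_on_prod_bound:
  fixes u :: "'a \<Rightarrow> 'b \<Rightarrow> 'c::banach"
  assumes le: "\<And>n m. norm (u n m) \<le> A n * B m"
    and A: "A summable_on UNIV" and B: "B summable_on UNIV"
    and A0: "\<And>n. 0 \<le> A n" and B0: "\<And>m. 0 \<le> B m"
  shows "(\<lambda>(n, m). u n m) summable_on UNIV"
proof -
  have "(\<lambda>x. A (fst x) * B (snd x)) summable_on UNIV \<times> UNIV"
  proof (rule summable_on_SigmaI)
    show "((\<lambda>y. A (fst (x, y)) * B (snd (x, y))) has_sum A x * infsum B UNIV) UNIV" for x
      using has_sum_cmult_right[OF has_sum_infsum[OF B], of "A x"] by simp
    show "(\<lambda>x. A x * infsum B UNIV) summable_on UNIV"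
      by (rule summable_on_cmult_left[OF A])
  qed (simp add: A0 B0)
  hence "(\<lambda>x. norm (case x of (n, m) \<Rightarrow> u n m)) summable_on UNIV"
    unfolding UNIV_Times_UNIV
    by (rule Infinite_Sum.abs_summable_on_comparison_test') (use le in \<open>auto split: prod.splits\<close>)
  thus ?thesis by (rule abs_summable_summable)
qed

text \<open>Domination by a product makes the family summable over all pairs, so both iterated sums
  equal the same total \<open>S\<close>.\<close>

lemma sums_swap:
  fixes u :: "nat \<Rightarrow> nat \<Rightarrow> complex"
  assumes le: "\<And>n m. norm (u n m) \<le> A n * B m"
    and A: "summable A" and B: "summable B"
    and A0: "\<And>n. 0 \<le> A n" and B0: "\<And>m. 0 \<le> B m"
    and f: "\<And>n. u n sums f n" and g: "\<And>m. (\<lambda>n. u n m) sums g m" and G: "g sums G"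
  shows "f sums G"
proof -
  have A': "A summable_on UNIV" and B': "B summable_on UNIV"
    using A B A0 B0 by (auto intro!: norm_summable_imp_summable_on)
  obtain S where S: "((\<lambda>(n, m). u n m) has_sum S) (UNIV \<times> UNIV)"
    using summable_on_prod_bound[OF le A' B' A0 B0] by (auto simp: summable_on_def)
  hence S': "((\<lambda>(m, n). u n m) has_sum S) (UNIV \<times> UNIV)"
    using has_sum_swap[of "\<lambda>(n, m). u n m" UNIV UNIV S] by simp
  have "summable (\<lambda>m. norm (u n m))" for n
    by (rule summable_comparison_test[OF _ summable_mult[OF B, of "A n"]]) (use le in auto)
  hence "((\<lambda>m. case (n, m) of (n, m) \<Rightarrow> u n m) has_sum f n) UNIV" for n
    using norm_summable_imp_has_sum[OF _ f] by simp
  from has_sum_SigmaD[OF S this] have fS: "f sums S" by (rule has_sum_imp_sums)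
  have "summable (\<lambda>n. norm (u n m))" for m
    by (rule summable_comparison_test[OF _ summable_mult2[OF A, of "B m"]]) (use le in auto)
  hence "((\<lambda>n. case (m, n) of (m, n) \<Rightarrow> u n m) has_sum g m) UNIV" for m
    using norm_summable_imp_has_sum[OF _ g] by simp
  from has_sum_SigmaD[OF S' this] have "g sums S" by (rule has_sum_imp_sums)
  with fS G show ?thesis using sums_unique2 by blast
qed

text \<open>
  The Bailey--Daum summation of \<open>\<^sub>2\<phi>\<^sub>1(a, b; aQ/b; Q, -Q/b)\<close>, with \<open>\<alpha> = Q/b\<close>. Following Heine,
  \<open>(a; Q)\<^sub>n / (a \<alpha>; Q)\<^sub>n\<close> is expanded by the \<open>q\<close>-binomial theorem and the sums are interchanged.
\<close>
lemma bailey_daum: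
  fixes a b \<alpha> Q :: complex
  assumes Q: "norm Q < 1" and a: "norm a < 1" and \<alpha>: "norm \<alpha> < 1" and b: "b * \<alpha> = Q"
  shows "(\<lambda>n. qpoch a Q n * qpoch b Q n / (qpoch Q Q n * qpoch (a * \<alpha>) Q n) * (- \<alpha>) ^ n) sums
    (qpoch_inf (- Q) Q * qpoch_inf (a * Q) (Q\<^sup>2) * qpoch_inf (a * \<alpha>\<^sup>2) (Q\<^sup>2)
      / (qpoch_inf (- \<alpha>) Q * qpoch_inf (a * \<alpha>) Q))"
proof -
  define A where "A = (\<lambda>n. qpoch b Q n / qpoch Q Q n * (- \<alpha>) ^ n)"
  define B where "B = (\<lambda>m. qpoch \<alpha> Q m / qpoch Q Q m * a ^ m)"
  have a\<alpha>: "norm (a * \<alpha>) < 1"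
    using norm_mult_power_lt_1[OF a \<alpha>, of 1] by simp
  have Q2: "norm (Q\<^sup>2) < 1" using Q by (rule norm_power_pos_lt_1) simp
  have aQ: "norm (a * Q ^ n) < 1" "norm (- \<alpha> * Q ^ n) < 1" for n
    using norm_mult_power_lt_1[OF _ Q] a \<alpha> by (simp_all only: norm_minus_cancel)
  have nz: "qpoch_inf a Q \<noteq> 0" "qpoch_inf (a * \<alpha>) Q \<noteq> 0" "qpoch_inf (- \<alpha>) Q \<noteq> 0"
    "qpoch_inf (a * Q ^ n) Q \<noteq> 0" "qpoch_inf (- \<alpha> * Q ^ n) Q \<noteq> 0"
    "qpoch a Q n \<noteq> 0" "qpoch (a * \<alpha>) Q n \<noteq> 0" "qpoch (- \<alpha>) Q n \<noteq> 0"
    "qpoch (- Q) Q n \<noteq> 0" "qpoch Q Q n \<noteq> 0" "qpoch_inf a (Q\<^sup>2) \<noteq> 0" for n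
    by (simp_all only: qpoch_inf_nonzero qpoch_nonzero Q a \<alpha> a\<alpha> aQ norm_minus_cancel Q2 simp_thms)
  let ?K = "qpoch_inf a Q / qpoch_inf (a * \<alpha>) Q"
  let ?L = "qpoch_inf (- Q) Q / qpoch_inf (- \<alpha>) Q"
  have "(\<lambda>n. A n * (qpoch_inf (\<alpha> * (a * Q ^ n)) Q / qpoch_inf (a * Q ^ n) Q)) sums
      (?L * (qpoch_inf (\<alpha>\<^sup>2 * a) (Q\<^sup>2) / qpoch_inf a (Q\<^sup>2)))"
  proof (rule sums_swap)
    \<comment> \<open>The two indices are coupled only through \<open>Q ^ (n * m)\<close>, whose
      norm is at most 1; hence two convergent q-binomial series dominate.\<close>
    show "norm (A n * B m * Q ^ (n * m)) \<le> norm (A n) * norm (B m)" for n m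
      unfolding norm_mult norm_power
      by (intro mult_left_le power_le_one) (use Q in auto)
    show "summable (\<lambda>n. norm (A n))"
      using summable_qbinom[OF Q, of 1 "- \<alpha>" b] \<alpha> by (simp add: A_def qbinom_coeff_1)
    show "summable (\<lambda>n. norm (B n))"
      using summable_qbinom[OF Q, of 1 a \<alpha>] a by (simp add: B_def qbinom_coeff_1)
    show "(\<lambda>m. A n * B m * Q ^ (n * m)) sums
        (A n * (qpoch_inf (\<alpha> * (a * Q ^ n)) Q / qpoch_inf (a * Q ^ n) Q))" for n
      using sums_mult[OF qbinom_theorem[OF Q aQ(1), of \<alpha> n], of "A n"]
      by (simp add: B_def power_mult_distrib power_mult[symmetric] mult_ac)
    show "(\<lambda>n. A n * B m * Q ^ (n * m)) sums
        (?L * (qpoch (\<alpha>\<^sup>2) (Q\<^sup>2) m / qpoch (Q\<^sup>2) (Q\<^sup>2) m * a ^ m))" for m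
    proof -
      have "A n * B m * Q ^ (n * m) = B m * (qpoch b Q n / qpoch Q Q n * (- \<alpha> * Q ^ m) ^ n)" for n
        by (simp only: A_def power_mult_distrib power_mult[symmetric] mult_ac times_divide_eq_right
            times_divide_eq_left)
      hence "(\<lambda>n. A n * B m * Q ^ (n * m)) sums
          (B m * (qpoch_inf (b * (- \<alpha> * Q ^ m)) Q / qpoch_inf (- \<alpha> * Q ^ m) Q))"
        using sums_mult[OF qbinom_theorem[OF Q aQ(2), of b m], of "B m"] by simp
      \<comment> \<open>The special argument -Q/b acts here: the numerator starts at
        \<open>- Q * Q ^ m\<close>, so \<open>(-Q; Q)_m\<close> appears in the denominator. Paired
        with \<open>(Q; Q)_m\<close>, and likewise \<open>(-\<alpha>; Q)_m\<close> with
        \<open>(\<alpha>; Q)_m\<close>, it leaves a q-binomial series to the base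
        \<open>Q^2\<close>.\<close>
      also have "b * (- \<alpha> * Q ^ m) = - Q * Q ^ m"
        using b by (simp add: mult.assoc[symmetric])
      also have "qpoch_inf (- Q * Q ^ m) Q = qpoch_inf (- Q) Q / qpoch (- Q) Q m"
        using qpoch_inf_split[OF Q, of "- Q" m] nz by (simp add: field_simps)
      also have "qpoch_inf (- \<alpha> * Q ^ m) Q = qpoch_inf (- \<alpha>) Q / qpoch (- \<alpha>) Q m"
        using qpoch_inf_split[OF Q, of "- \<alpha>" m] nz by (simp add: field_simps)
      also have "B m * (qpoch_inf (- Q) Q / qpoch (- Q) Q m / (qpoch_inf (- \<alpha>) Q / qpoch (- \<alpha>) Q m))
          = ?L * (qpoch (\<alpha>\<^sup>2) (Q\<^sup>2) m / qpoch (Q\<^sup>2) (Q\<^sup>2) m * a ^ m)"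
        unfolding qpoch_mult_minus[symmetric] B_def by (simp add: mult_ac)
      finally show ?thesis .
    qed
    show "(\<lambda>m. ?L * (qpoch (\<alpha>\<^sup>2) (Q\<^sup>2) m / qpoch (Q\<^sup>2) (Q\<^sup>2) m * a ^ m)) sums
        (?L * (qpoch_inf (\<alpha>\<^sup>2 * a) (Q\<^sup>2) / qpoch_inf a (Q\<^sup>2)))"
      by (intro sums_mult qbinom_theorem Q2 a)
  qed auto
  from sums_mult[OF this, of ?K]
  have "(\<lambda>n. ?K * (A n * (qpoch_inf (\<alpha> * (a * Q ^ n)) Q / qpoch_inf (a * Q ^ n) Q))) sums
      (?K * (?L * (qpoch_inf (\<alpha>\<^sup>2 * a) (Q\<^sup>2) / qpoch_inf a (Q\<^sup>2))))" .
  also have "?K * (?L * (qpoch_inf (\<alpha>\<^sup>2 * a) (Q\<^sup>2) / qpoch_inf a (Q\<^sup>2))) =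
    qpoch_inf (- Q) Q * qpoch_inf (a * Q) (Q\<^sup>2) * qpoch_inf (a * \<alpha>\<^sup>2) (Q\<^sup>2)
      / (qpoch_inf (- \<alpha>) Q * qpoch_inf (a * \<alpha>) Q)"
    using nz by (simp add: qpoch_inf_even_odd[OF Q, of a] mult_ac)
  \<comment> \<open>Splitting off \<open>n\<close> factors from the products in \<open>?K\<close>
    restores \<open>(a; Q)_n / (a \<alpha>; Q)_n\<close>.\<close>
  also have "(\<lambda>n. ?K * (A n * (qpoch_inf (\<alpha> * (a * Q ^ n)) Q / qpoch_inf (a * Q ^ n) Q)))
      = (\<lambda>n. qpoch a Q n * qpoch b Q n / (qpoch Q Q n * qpoch (a * \<alpha>) Q n) * (- \<alpha>) ^ n)"
  proof
    fix n
    have 1: "qpoch_inf a Q = qpoch a Q n * qpoch_inf (a * Q ^ n) Q"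
      by (rule qpoch_inf_split[OF Q])
    have 2: "qpoch_inf (a * \<alpha>) Q = qpoch (a * \<alpha>) Q n * qpoch_inf (\<alpha> * (a * Q ^ n)) Q"
      using qpoch_inf_split[OF Q, of "a * \<alpha>" n] by (simp add: mult_ac)
    have 3: "qpoch_inf (\<alpha> * (a * Q ^ n)) Q \<noteq> 0"
      using nz(2) unfolding 2 by simp
    show "?K * (A n * (qpoch_inf (\<alpha> * (a * Q ^ n)) Q / qpoch_inf (a * Q ^ n) Q))
        = qpoch a Q n * qpoch b Q n / (qpoch Q Q n * qpoch (a * \<alpha>) Q n) * (- \<alpha>) ^ n"
      unfolding 1 2 A_def using nz(4)[of n] nz(7)[of n] 3 by (simp add: mult_ac)
  qed
  finally show ?thesis .
qed

section \<open>A recurrence solved by a basic hypergeometric series\<close>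

text \<open>The substitution z -> Q z. On formal series the q-difference equation can be manipulated
  without any convergence argument.\<close>

definition fps_dilate :: "complex \<Rightarrow> complex fps \<Rightarrow> complex fps" where
  "fps_dilate Q f = Abs_fps (\<lambda>n. Q ^ n * fps_nth f n)"

lemma fps_dilate_nth [simp]: "fps_nth (fps_dilate Q f) n = Q ^ n * fps_nth f n"
  by (simp add: fps_dilate_def)

lemma fps_dilate_mult: "fps_dilate Q (f * g) = fps_dilate Q f * fps_dilate Q g"
proof (rule fps_ext)
  fix n
  have "Q ^ n * (\<Sum>i=0..n. fps_nth f i * fps_nth g (n - i))
      = (\<Sum>i=0..n. (Q ^ i * fps_nth f i) * (Q ^ (n - i) * fps_nth g (n - i)))"
    unfolding sum_distrib_left
    by (rule sum.cong) (auto simp: mult_ac power_add[symmetric])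
  thus "fps_nth (fps_dilate Q (f * g)) n = fps_nth (fps_dilate Q f * fps_dilate Q g) n"
    by (simp add: fps_mult_nth)
qed

lemma fps_dilate_linear:
  "fps_dilate Q (1 + fps_const a * fps_X) = 1 + fps_const (a * Q) * fps_X"
  by (rule fps_ext) (auto simp: fps_X_nth le_Suc_eq)

text \<open>The coefficient of z^(n+1) in a second-order q-difference equation, simplified by
  \<open>b * \<alpha> = Q\<close>. The case distinction encodes c_(-1) = 0, as \<open>n - 1\<close>
  is truncated at \<open>n = 0\<close>.\<close>

definition kummer_rec :: "complex \<Rightarrow> complex \<Rightarrow> complex \<Rightarrow> complex \<Rightarrow> (nat \<Rightarrow> complex) \<Rightarrow> bool" where
  "kummer_rec Q \<alpha> b r c \<longleftrightarrow> (\<forall>n. (1 - Q ^ Suc n) * (1 - r * Q ^ Suc n) * c (Suc n)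
     = ((1 + r) * Q * Q ^ n - r * Q * (b + \<alpha>) * (Q ^ n)\<^sup>2) * c n
       - (if n = 0 then 0 else r * Q * (Q ^ n)\<^sup>2 * c (n - 1)))"

lemma kummer_rec_cmult:
  assumes "kummer_rec Q \<alpha> b r c"
  shows "kummer_rec Q \<alpha> b r (\<lambda>n. k * c n)"
  unfolding kummer_rec_def
proof
  fix n
  have "(1 - Q ^ Suc n) * (1 - r * Q ^ Suc n) * (k * c (Suc n))
      = k * ((1 - Q ^ Suc n) * (1 - r * Q ^ Suc n) * c (Suc n))"
    by (simp only: mult_ac)
  also have "\<dots> = k * (((1 + r) * Q * Q ^ n - r * Q * (b + \<alpha>) * (Q ^ n)\<^sup>2) * c n
       - (if n = 0 then 0 else r * Q * (Q ^ n)\<^sup>2 * c (n - 1)))"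
    using assms unfolding kummer_rec_def by (simp only:)
  finally show "(1 - Q ^ Suc n) * (1 - r * Q ^ Suc n) * (k * c (Suc n))
     = ((1 + r) * Q * Q ^ n - r * Q * (b + \<alpha>) * (Q ^ n)\<^sup>2) * (k * c n)
       - (if n = 0 then 0 else r * Q * (Q ^ n)\<^sup>2 * (k * c (n - 1)))"
    by (simp add: right_diff_distrib mult_ac)
qed

text \<open>The leading coefficient never vanishes for \<open>Q\<close> and \<open>r\<close> in the
  unit disc, so \<open>c 0\<close> determines the whole solution.\<close>

lemma kummer_rec_unique:
  assumes "norm Q < 1" "norm r < 1" "kummer_rec Q \<alpha> b r c" "kummer_rec Q \<alpha> b r d" "c 0 = d 0"
  shows "c n = d n"
proof (induction n rule: less_induct)
  case (less n)
  show ?case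
  proof (cases n)
    case (Suc m)
    have nz: "(1 - Q ^ Suc m) * (1 - r * Q ^ Suc m) \<noteq> 0"
      using one_minus_nonzero[OF norm_power_Suc_lt_1[OF assms(1), of m]]
        one_minus_nonzero[OF norm_mult_power_lt_1[OF assms(2,1), of "Suc m"]]
      by (simp del: right_minus_eq power_Suc)
    have "(1 - Q ^ Suc m) * (1 - r * Q ^ Suc m) * c (Suc m)
        = (1 - Q ^ Suc m) * (1 - r * Q ^ Suc m) * d (Suc m)"
      using assms(3,4) less.IH[of m] less.IH[of "m - 1"] unfolding kummer_rec_def by (simp add: Suc)
    with nz Suc show ?thesis by (simp only: mult_cancel_left) simp
  qed (simp add: assms)
qed

lemma kummer_rec_of_fps:
  fixes C :: "complex fps" and Q :: complex
  defines "S \<equiv> fps_dilate Q"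
  assumes b: "b * \<alpha> = Q"
    and C: "C = fps_const (1 + r) * (1 + fps_const Q * fps_X) * S C
      - fps_const r * ((1 + fps_const (b * Q) * fps_X) * (1 + fps_const (\<alpha> * Q) * fps_X)) * S (S C)"
  shows "kummer_rec Q \<alpha> b r (fps_nth C)"
  unfolding kummer_rec_def
proof
  fix n
  \<comment> \<open>This makes the coefficient of \<open>c (n - 1)\<close> equal to
    \<open>r * Q^3 * Q^(2*(n-1)) = r * Q * (Q^n)^2\<close>.\<close>
  have "b * Q * (\<alpha> * Q) = Q ^ 3"
    using b by (simp add: power3_eq_cube mult_ac)
  hence "fps_const (b * Q) * fps_const (\<alpha> * Q) = fps_const (Q ^ 3)"
    by (simp only: fps_const_mult)
  hence quad: "(1 + fps_const (b * Q) * fps_X) * (1 + fps_const (\<alpha> * Q) * fps_X) =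
      1 + fps_const (b * Q + \<alpha> * Q) * fps_X + fps_const (Q ^ 3) * (fps_X * fps_X)"
    unfolding fps_const_add[symmetric] by (simp only: algebra_simps mult_1_left mult_1_right)
  have "C = fps_const (1 + r) * (S C + fps_const Q * (fps_X * S C))
      - fps_const r * (S (S C) + fps_const (b * Q + \<alpha> * Q) * (fps_X * S (S C))
        + fps_const (Q ^ 3) * (fps_X * (fps_X * S (S C))))"
    by (subst (1) C, unfold quad) (simp only: algebra_simps mult_1_left mult_1_right)
  hence "fps_nth C (Suc n) = fps_nth (fps_const (1 + r) * (S C + fps_const Q * (fps_X * S C))
      - fps_const r * (S (S C) + fps_const (b * Q + \<alpha> * Q) * (fps_X * S (S C))
        + fps_const (Q ^ 3) * (fps_X * (fps_X * S (S C))))) (Suc n)"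
    by (rule arg_cong)
  thus "(1 - Q ^ Suc n) * (1 - r * Q ^ Suc n) * fps_nth C (Suc n)
     = ((1 + r) * Q * Q ^ n - r * Q * (b + \<alpha>) * (Q ^ n)\<^sup>2) * fps_nth C n
       - (if n = 0 then 0 else r * Q * (Q ^ n)\<^sup>2 * fps_nth C (n - 1))"
    by (cases n) (simp_all add: S_def algebra_simps power2_eq_square power3_eq_cube)
qed

text \<open>
  In terms of \<open>F(z) = \<Sum> c\<^sub>n z\<^sup>n\<close> the recurrence reads
  \<open>F(z) = (1 + r)(1 + Q z) F(Q z) - r (1 + b Q z)(1 + \<alpha> Q z) F(Q\<^sup>2 z)\<close>, and it is solved by
  \<open>(-\<alpha> z; Q)\<^sub>\<infinity> \<^sub>2\<phi>\<^sub>1(r b, b; r Q; Q, -\<alpha> z)\<close>.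
\<close>
lemma kummer_rec_sums:
  fixes Q \<alpha> b r :: complex
  assumes Q: "norm Q < 1" and \<alpha>: "norm \<alpha> < 1" and r: "norm r < 1" and rb: "norm (r * b) < 1"
    and b: "b * \<alpha> = Q" and c: "kummer_rec Q \<alpha> b r c"
  shows "c sums (c 0 * (qpoch_inf (- Q) Q * qpoch_inf (r * b * Q) (Q\<^sup>2) * qpoch_inf (r * \<alpha> * Q) (Q\<^sup>2)
    / qpoch_inf (r * Q) Q))"
proof -
  define P where "P = Abs_fps (\<lambda>n. qbinom_coeff 0 (- 1) Q n * \<alpha> ^ n)"
  define e where "e = (\<lambda>n. qpoch (r * b) Q n * qpoch b Q n / (qpoch Q Q n * qpoch (r * Q) Q n) * (- \<alpha>) ^ n)"
  define E where "E = Abs_fps e"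
  have rQ: "norm (r * Q ^ n) < 1" for n by (rule norm_mult_power_lt_1[OF r Q])
  have rba: "r * b * \<alpha> = r * Q" using b by (simp add: mult_ac)
  \<comment> \<open>\<open>P\<close> is the Euler series of the product
    \<open>(-\<alpha> z; Q)\<close>; detaching the first factor of that product gives this
    equation.\<close>
  have P_eq: "P = (1 + fps_const \<alpha> * fps_X) * fps_dilate Q P"
  proof (rule fps_ext)
    fix n show "fps_nth P n = fps_nth ((1 + fps_const \<alpha> * fps_X) * fps_dilate Q P) n"
    proof (cases n)
      case (Suc m)
      have "(1 - Q ^ Suc m) * fps_nth P (Suc m) = \<alpha> * (Q ^ m * fps_nth P m)"
        using qbinom_coeff_Suc[OF Q, of m 0 "- 1"] unfolding P_def fps_nth_Abs_fps
        by (simp only: power_Suc diff_0 minus_mult_minus mult_1 mult_minus_left minus_minus mult_ac)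
      thus ?thesis by (simp add: Suc distrib_right mult.assoc) (simp add: algebra_simps)
    qed (simp add: P_def)
  qed
  have e_rec: "(1 - Q ^ Suc n) * (1 - r * Q ^ Suc n) * e (Suc n)
      = - \<alpha> * (1 - b * Q ^ n) * (1 - r * b * Q ^ n) * e n" for n
  proof -
    have "1 - Q * Q ^ n \<noteq> 0" "1 - r * Q * Q ^ n \<noteq> 0"
      using one_minus_nonzero[OF norm_power_Suc_lt_1[OF Q, of n]] one_minus_nonzero[OF rQ[of "Suc n"]]
      by (simp_all del: right_minus_eq add: mult.assoc)
    thus ?thesis by (simp add: e_def qpoch_Suc mult.assoc del: right_minus_eq)
  qed
  \<comment> \<open>The q-difference equation of the 2phi1, equivalent to \<open>e_rec\<close>;
    \<open>b * \<alpha> = Q\<close> turns the shifted coefficients into \<open>Q\<close> and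
    \<open>b * Q\<close>.\<close>
  have E_eq: "(1 + fps_const \<alpha> * fps_X) * E
      = fps_const (1 + r) * (1 + fps_const Q * fps_X) * fps_dilate Q E
        - fps_const r * (1 + fps_const (b * Q) * fps_X) * fps_dilate Q (fps_dilate Q E)"
  proof -
    have "E + fps_const \<alpha> * (fps_X * E)
      = fps_const (1 + r) * (fps_dilate Q E + fps_const Q * (fps_X * fps_dilate Q E))
        - fps_const r * (fps_dilate Q (fps_dilate Q E)
          + fps_const (b * Q) * (fps_X * fps_dilate Q (fps_dilate Q E)))"
    proof (rule fps_ext)
      fix n show "fps_nth (E + fps_const \<alpha> * (fps_X * E)) n
        = fps_nth (fps_const (1 + r) * (fps_dilate Q E + fps_const Q * (fps_X * fps_dilate Q E))
          - fps_const r * (fps_dilate Q (fps_dilate Q E)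
          + fps_const (b * Q) * (fps_X * fps_dilate Q (fps_dilate Q E)))) n"
      proof (cases n)
        case (Suc m)
        from e_rec[of m] show ?thesis
          unfolding b[symmetric] by (simp add: Suc E_def algebra_simps)
      qed (simp add: E_def e_def algebra_simps)
    qed
    thus ?thesis by (simp add: algebra_simps del: fps_const_add fps_const_mult)
  qed
  have PE: "P * E = fps_const (1 + r) * (1 + fps_const Q * fps_X) * fps_dilate Q (P * E)
      - fps_const r * ((1 + fps_const (b * Q) * fps_X) * (1 + fps_const (\<alpha> * Q) * fps_X))
        * fps_dilate Q (fps_dilate Q (P * E))"
  proof -
    have SP: "fps_dilate Q P = (1 + fps_const (\<alpha> * Q) * fps_X) * fps_dilate Q (fps_dilate Q P)"
      by (subst (1) P_eq) (simp only: fps_dilate_mult fps_dilate_linear)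
    \<comment> \<open>Multiplying \<open>E_eq\<close> by P(Qz) absorbs the factor 1 + \<alpha> z
      into P(z), while P(Qz) = (1 + \<alpha> Q z) P(Q^2 z) supplies the second linear factor of the
      last term.\<close>
    have "P * E = fps_dilate Q P * ((1 + fps_const \<alpha> * fps_X) * E)"
      by (subst (1) P_eq) (simp only: mult_ac)
    also have "\<dots> = fps_const (1 + r) * (1 + fps_const Q * fps_X) * (fps_dilate Q P * fps_dilate Q E)
      - fps_const r * (1 + fps_const (b * Q) * fps_X) * (fps_dilate Q P * fps_dilate Q (fps_dilate Q E))"
      unfolding E_eq by (simp only: algebra_simps)
    also have "fps_dilate Q P * fps_dilate Q (fps_dilate Q E)
        = (1 + fps_const (\<alpha> * Q) * fps_X) * (fps_dilate Q (fps_dilate Q P) * fps_dilate Q (fps_dilate Q E))"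
      by (subst (1) SP) (simp only: mult_ac)
    finally show ?thesis unfolding fps_dilate_mult by (rule trans) (simp only: mult_ac)
  qed
  have coeff: "fps_nth (P * E) n = (\<Sum>i\<le>n. (qbinom_coeff 0 (- 1) Q i * \<alpha> ^ i) * e (n - i))" for n
    by (simp add: fps_mult_nth P_def E_def atLeast0AtMost)
  have rec: "kummer_rec Q \<alpha> b r (\<lambda>n. c 0 * fps_nth (P * E) n)"
    by (intro kummer_rec_cmult kummer_rec_of_fps b PE)
  have c_eq: "c n = c 0 * (\<Sum>i\<le>n. (qbinom_coeff 0 (- 1) Q i * \<alpha> ^ i) * e (n - i))" for n
    unfolding coeff[symmetric]
    by (rule kummer_rec_unique[OF Q r c rec]) (simp add: P_def E_def e_def)
  have sP: "summable (\<lambda>n. norm (qbinom_coeff 0 (- 1) Q n * \<alpha> ^ n))"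
    by (rule summable_qbinom[OF Q _ \<alpha>]) simp
  have sE: "summable (\<lambda>n. norm (e n))"
  proof (rule summable_norm_of_ratio)
    let ?g = "\<lambda>n. - \<alpha> * (1 - b * Q ^ n) * (1 - r * b * Q ^ n) / ((1 - Q * Q ^ n) * (1 - r * Q * Q ^ n))"
    show "e (Suc n) = ?g n * e n" for n
    proof -
      have nz: "(1 - Q * Q ^ n) * (1 - r * Q * Q ^ n) \<noteq> 0"
        using one_minus_nonzero[OF norm_power_Suc_lt_1[OF Q, of n]] one_minus_nonzero[OF rQ[of "Suc n"]]
        by (simp del: right_minus_eq add: mult.assoc)
      show ?thesis
        unfolding times_divide_eq_left nonzero_eq_divide_eq[OF nz]
        using e_rec[of n] by (simp only: power_Suc mult_ac)
    qed
    have "?g \<longlonglongrightarrow> - \<alpha> * (1 - b * 0) * (1 - r * b * 0) / ((1 - Q * 0) * (1 - r * Q * 0))"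
      by (intro tendsto_intros power_tendsto_0 Q) simp
    thus "?g \<longlonglongrightarrow> - \<alpha>" by simp
  qed (use \<alpha> in simp)
  have "(\<lambda>n. qbinom_coeff 0 (- 1) Q n * \<alpha> ^ n) sums qpoch_inf (- \<alpha>) Q"
    using qbinom_sums[OF Q _ \<alpha>, of 0 "- 1"] by simp
  moreover have "e sums (qpoch_inf (- Q) Q * qpoch_inf (r * b * Q) (Q\<^sup>2) * qpoch_inf (r * \<alpha> * Q) (Q\<^sup>2)
      / (qpoch_inf (- \<alpha>) Q * qpoch_inf (r * Q) Q))"
  \<comment> \<open>Bailey-Daum is applied with \<open>a = r * b\<close>, for which
    \<open>a * \<alpha> = r * Q\<close>. Its denominator \<open>(-\<alpha>; Q)\<close> will cancel
    against the value of \<open>P\<close> at z = 1.\<close>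
  proof -
    have rba2: "r * b * \<alpha>\<^sup>2 = r * \<alpha> * Q"
      unfolding b[symmetric] by (simp add: power2_eq_square)
    show ?thesis using bailey_daum[OF Q rb \<alpha> b] unfolding e_def rba rba2 .
  qed
  ultimately have "(\<lambda>n. \<Sum>i\<le>n. (qbinom_coeff 0 (- 1) Q i * \<alpha> ^ i) * e (n - i)) sums
      (qpoch_inf (- \<alpha>) Q * (qpoch_inf (- Q) Q * qpoch_inf (r * b * Q) (Q\<^sup>2) * qpoch_inf (r * \<alpha> * Q) (Q\<^sup>2)
      / (qpoch_inf (- \<alpha>) Q * qpoch_inf (r * Q) Q)))"
    using Cauchy_product_sums[OF sP sE] by (simp add: sums_iff)
  moreover have "qpoch_inf (- \<alpha>) Q \<noteq> 0"
    by (rule qpoch_inf_nonzero) (use \<alpha> Q in auto)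
  ultimately have "(\<lambda>n. \<Sum>i\<le>n. (qbinom_coeff 0 (- 1) Q i * \<alpha> ^ i) * e (n - i)) sums
      (qpoch_inf (- Q) Q * qpoch_inf (r * b * Q) (Q\<^sup>2) * qpoch_inf (r * \<alpha> * Q) (Q\<^sup>2) / qpoch_inf (r * Q) Q)"
    by simp
  from sums_mult[OF this, of "c 0"] show ?thesis
    unfolding c_eq[symmetric] .
qed

section \<open>Recurrences for the diagonal sums\<close>

text \<open>What the sum over \<open>i\<close> leaves behind, without the common factor
  \<open>qpoch_inf (- q) q\<close>. A weight \<open>q ^ ((d + 1) * i)\<close> in that sum produces
  the offset \<open>d\<close>; \<open>s\<close> and \<open>t\<close> are the linear exponents of
  \<open>j\<close> and \<open>k\<close>.\<close>

definition pterm :: "complex \<Rightarrow> nat \<Rightarrow> nat \<Rightarrow> nat \<Rightarrow> nat \<Rightarrow> nat \<Rightarrow> complex" where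
  "pterm q d s t j k = q ^ (((2 * j + 3 * k) choose 2) + j\<^sup>2 + s * j + t * k) /
     (qpoch (- q) q (2 * j + 3 * k + d) * qpoch (q\<^sup>2) (q\<^sup>2) j * qpoch (q ^ 3) (q ^ 3) k)"

lemma choose_two_add: "(m + n) choose 2 = (m choose 2) + (n choose 2) + m * (n::nat)"
  by (induction n) (simp_all add: numeral_2_eq_2)

lemma one_plus_nonzero: "norm (z::complex) < 1 \<Longrightarrow> 1 + z \<noteq> 0"
  using one_minus_nonzero[of "- z"] by simp

lemma one_plus_power_nonzero:
  fixes q :: complex
  assumes q: "norm q < 1" and "0 < i"
  shows "1 + q ^ i * q ^ n \<noteq> 0"
  using one_plus_nonzero[OF norm_mult_power_lt_1[OF norm_power_pos_lt_1[OF q] q]] assms(2) .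

text \<open>Raising \<open>j\<close> adds 2 to M = 2j + 3k: the binomial exponent gains 2M + 1, the
  square gains 2j + 1, and two factors 1 + q^i join the denominator. The factor
  \<open>1 - q ^ (2 * Suc j)\<close> stays on the left because the telescoping summands carry
  it.\<close>

lemma pterm_Suc_left:
  assumes q: "norm q < 1"
  shows "pterm q d s t (Suc j) k * (1 - q ^ (2 * Suc j))
    = pterm q d s t j k * (q ^ (s + 2) * (q ^ (2 * j + 3 * k))\<^sup>2 * q ^ (2 * j))
      / ((1 + q ^ (d + 1) * q ^ (2 * j + 3 * k)) * (1 + q ^ (d + 2) * q ^ (2 * j + 3 * k)))"
proof -
  have nz: "1 - q ^ (2 * Suc j) \<noteq> 0"
    by (rule one_minus_nonzero, rule norm_power_pos_lt_1[OF q]) simp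
  have 1: "((2 * Suc j + 3 * k) choose 2) + (Suc j)\<^sup>2 + s * Suc j + t * k
      = (((2 * j + 3 * k) choose 2) + j\<^sup>2 + s * j + t * k) + ((s + 2) + 2 * (2 * j + 3 * k) + 2 * j)"
  proof -
    have "2 * Suc j + 3 * k = (2 * j + 3 * k) + 2" by simp
    hence "(2 * Suc j + 3 * k) choose 2 = ((2 * j + 3 * k) choose 2) + 1 + 2 * (2 * j + 3 * k)"
      by (simp only: choose_two_add) simp
    thus ?thesis by (simp add: power2_eq_square)
  qed
  have 2: "qpoch (- q) q (2 * Suc j + 3 * k + d) = qpoch (- q) q (2 * j + 3 * k + d)
      * ((1 + q ^ (d + 1) * q ^ (2 * j + 3 * k)) * (1 + q ^ (d + 2) * q ^ (2 * j + 3 * k)))"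
  proof -
    have "2 * Suc j + 3 * k + d = Suc (Suc (2 * j + 3 * k + d))" by simp
    thus ?thesis by (simp only: qpoch_Suc) (simp add: power_add mult_ac)
  qed
  have 3: "qpoch (q\<^sup>2) (q\<^sup>2) (Suc j) = qpoch (q\<^sup>2) (q\<^sup>2) j * (1 - q ^ (2 * Suc j))"
    by (simp add: qpoch_Suc power_mult[symmetric] power_add[symmetric])
  have 4: "q ^ (A + ((s + 2) + 2 * N + 2 * j)) = q ^ A * (q ^ (s + 2) * (q ^ N)\<^sup>2 * q ^ (2 * j))" for A N
    by (simp only: power_add power_even_eq[of q N] mult.assoc)
  have 5: "(x * y) / ((a * g) * (c * e) * h) * e = x / (a * c * h) * y / g"
    if "e \<noteq> 0" for x y a g c e h :: complex using that by simp
  show ?thesis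
    unfolding pterm_def 1 2 3 4 using nz by (rule 5)
qed

lemma pterm_Suc_right:
  assumes q: "norm q < 1"
  shows "pterm q d s t j (Suc k) * (1 - q ^ (3 * Suc k))
    = pterm q d s t j k * (q ^ (t + 3) * (q ^ (2 * j + 3 * k)) ^ 3)
      / ((1 + q ^ (d + 1) * q ^ (2 * j + 3 * k)) * (1 + q ^ (d + 2) * q ^ (2 * j + 3 * k))
        * (1 + q ^ (d + 3) * q ^ (2 * j + 3 * k)))"
proof -
  have nz: "1 - q ^ (3 * Suc k) \<noteq> 0"
    by (rule one_minus_nonzero, rule norm_power_pos_lt_1[OF q]) simp
  have 1: "((2 * j + 3 * Suc k) choose 2) + j\<^sup>2 + s * j + t * Suc k
      = (((2 * j + 3 * k) choose 2) + j\<^sup>2 + s * j + t * k) + ((t + 3) + 3 * (2 * j + 3 * k))"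
  proof -
    have "2 * j + 3 * Suc k = (2 * j + 3 * k) + 3" "(3::nat) choose 2 = 3"
      by (simp_all add: eval_nat_numeral)
    hence "(2 * j + 3 * Suc k) choose 2 = ((2 * j + 3 * k) choose 2) + 3 + 3 * (2 * j + 3 * k)"
      by (simp only: choose_two_add mult.commute[of _ 3])
    thus ?thesis by simp
  qed
  have 2: "qpoch (- q) q (2 * j + 3 * Suc k + d) = qpoch (- q) q (2 * j + 3 * k + d)
      * ((1 + q ^ (d + 1) * q ^ (2 * j + 3 * k)) * (1 + q ^ (d + 2) * q ^ (2 * j + 3 * k))
        * (1 + q ^ (d + 3) * q ^ (2 * j + 3 * k)))"
  proof -
    have "2 * j + 3 * Suc k + d = Suc (Suc (Suc (2 * j + 3 * k + d)))" by simp
    thus ?thesis by (simp only: qpoch_Suc) (simp add: power_add power3_eq_cube power2_eq_square mult_ac)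
  qed
  have 3: "qpoch (q ^ 3) (q ^ 3) (Suc k) = qpoch (q ^ 3) (q ^ 3) k * (1 - q ^ (3 * Suc k))"
    by (simp add: qpoch_Suc power_mult[symmetric] power_add[symmetric])
  have 4: "q ^ (A + ((t + 3) + 3 * N)) = q ^ A * (q ^ (t + 3) * (q ^ N) ^ 3)" for A N
    by (simp only: power_add power_mult[symmetric] mult.commute[of 3] mult.assoc)
  have 5: "(x * y) / ((a * g) * c * (h * e)) * e = x / (a * c * h) * y / g"
    if "e \<noteq> 0" for x y a g c e h :: complex using that by simp
  show ?thesis
    unfolding pterm_def 1 2 3 4 using nz by (rule 5)
qed

text \<open>The vanishing boundary term turns a sum over diagonal n + 1 into one over diagonal n;
  this is the only summation device in the telescoping.\<close>

lemma sum_diagonal_shift_left: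
  fixes h :: "nat \<Rightarrow> nat \<Rightarrow> 'a::comm_monoid_add"
  assumes "\<And>k. h 0 k = 0"
  shows "(\<Sum>j\<le>Suc n. h j (Suc n - j)) = (\<Sum>j\<le>n. h (Suc j) (n - j))"
  by (subst sum.atMost_Suc_shift) (simp add: assms)

lemma sum_diagonal_shift_right:
  fixes h :: "nat \<Rightarrow> nat \<Rightarrow> 'a::comm_monoid_add"
  assumes "\<And>j. h j 0 = 0"
  shows "(\<Sum>j\<le>Suc n. h j (Suc n - j)) = (\<Sum>j\<le>n. h j (Suc (n - j)))"
  by (simp add: assms Suc_diff_le)

text \<open>
  Creative telescoping for the diagonal sums of \<^term>\<open>pterm\<close>. With \<open>X = q\<^sup>2\<^sup>j\<close>, \<open>V = q\<^sup>3\<^sup>k\<close> and \<open>m = X V\<close> we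
  have \<open>q\<^sup>6\<^sup>n = X m\<^sup>2\<close> on the diagonal \<open>j + k = n\<close>. The factor \<open>(1 - X m\<^sup>2)(1 - r X m\<^sup>2) w(m)\<close> splits as
  \<open>(1 - X)(P + X R) + (1 - V)(X S + X\<^sup>2 U)\<close>, for an arbitrary \<open>S\<close>, and each of the two parts is a shift of
  a sum over the previous diagonal. The certificate is the polynomial \<open>S\<close>, found by linear
  algebra on its coefficients: it has to be such that what remains after the first shift is
  \<open>(1 - X) X G(m)\<close>.
\<close>
lemma kummer_rec_diagonal:
  fixes q r :: complex and d s t :: nat and w S :: "complex \<Rightarrow> complex"
  defines "f \<equiv> \<lambda>d i m. 1 + q ^ (d + i) * m"
  defines "U \<equiv> \<lambda>m. w m * (1 + m) * (1 - r * m\<^sup>2) - S m"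
  defines "P \<equiv> \<lambda>m. w m + m * S m"
  defines "R \<equiv> \<lambda>m. U m - r * m ^ 4 * w m"
  defines "G \<equiv> \<lambda>m. q ^ (s + 2) * m\<^sup>2 * f d 3 m * P (q\<^sup>2 * m) + q ^ (t + 3) * m ^ 3 * S (q ^ 3 * m)
    - (1 + r) * q ^ 6 * m\<^sup>2 * w m * (f d 1 m * f d 2 m * f d 3 m)"
  assumes q: "norm q < 1"
    and cert1: "\<And>m. q ^ (s + 4) * m\<^sup>2 * f d 3 m * R (q\<^sup>2 * m) + q ^ (t + 3) * m ^ 3 * U (q ^ 3 * m)
      + r * q ^ 6 * (b + \<alpha>) * m ^ 4 * w m * (f d 1 m * f d 2 m * f d 3 m) = - G m"
    and cert2: "\<And>m. q ^ (s + 4) * G (q\<^sup>2 * m) = - (r * q ^ 18 * m\<^sup>2 * w m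
      * (f d 1 m * f d 2 m * f d 3 m * f d 4 m * f d 5 m))"
  shows "kummer_rec (q ^ 6) \<alpha> b r (\<lambda>n. \<Sum>j\<le>n. pterm q d s t j (n - j) * w (q ^ (2 * j + 3 * (n - j))))"
  unfolding kummer_rec_def
proof
  fix n
  define M where "M = (\<lambda>j k. q ^ (2 * j + 3 * k))"
  define T where "T = pterm q d s t"
  define F where "F = (\<lambda>j k. f d 1 (M j k) * f d 2 (M j k) * f d 3 (M j k))"
  \<comment> \<open>\<open>h1\<close> and \<open>h3\<close> vanish at \<open>j = 0\<close> and
    \<open>h2\<close> at \<open>k = 0\<close>, so each allows one index shift. \<open>h3\<close> is
    the remainder of the first round of shifts.\<close>
  define h1 where "h1 = (\<lambda>j k. T j k * (1 - q ^ (2 * j)) * (P (M j k) + q ^ (2 * j) * R (M j k)))"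
  define h2 where "h2 = (\<lambda>j k. T j k * (1 - q ^ (3 * k)) * (q ^ (2 * j) * S (M j k) + (q ^ (2 * j))\<^sup>2 * U (M j k)))"
  define h3 where "h3 = (\<lambda>j k. T j k * (1 - q ^ (2 * j)) * (q ^ (2 * j) * G (M j k) / F j k))"
  let ?Y = "(q ^ 6) ^ n"
  have M_left: "M (Suc j) k = q\<^sup>2 * M j k" and M_right: "M j (Suc k) = q ^ 3 * M j k" for j k
    by (simp_all add: M_def power_add power2_eq_square power3_eq_cube)
  have M_split: "M j k = q ^ (2 * j) * q ^ (3 * k)" for j k
    by (simp add: M_def power_add)
  have Y: "(q ^ 6) ^ (j + k) = q ^ (2 * j) * (M j k)\<^sup>2" for j k
    by (simp add: M_def power_mult[symmetric] power_add[symmetric] algebra_simps)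
  have f_nz: "f d i (M j k) \<noteq> 0" if "0 < i" for i j k
    using one_plus_power_nonzero[OF q] that unfolding f_def M_def by simp
  have F_nz: "F j k \<noteq> 0" for j k
    by (simp add: F_def f_nz)
  have f_shift: "f d 1 (q\<^sup>2 * m) = f d 3 m" "f d 2 (q\<^sup>2 * m) = f d 4 m" "f d 3 (q\<^sup>2 * m) = f d 5 m" for m
    by (simp_all add: f_def power_add numeral_eq_Suc mult_ac)
  have T_left: "T (Suc j) k * (1 - q ^ (2 * Suc j)) = T j k * (q ^ (s + 2) * (M j k)\<^sup>2 * q ^ (2 * j))
      / (f d 1 (M j k) * f d 2 (M j k))" for j k
    unfolding T_def M_def f_def by (rule pterm_Suc_left[OF q])
  have T_right: "T j (Suc k) * (1 - q ^ (3 * Suc k)) = T j k * (q ^ (t + 3) * (M j k) ^ 3) / F j k" for j k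
    unfolding T_def M_def f_def F_def by (rule pterm_Suc_right[OF q])
  have split: "T j k * w (M j k) * ((1 - (q ^ 6) ^ (j + k)) * (1 - r * (q ^ 6) ^ (j + k)))
      = h1 j k + h2 j k" for j k
    unfolding h1_def h2_def Y M_split P_def R_def U_def by algebra
  have "(1 - (q ^ 6) ^ Suc n) * (1 - r * (q ^ 6) ^ Suc n) * (\<Sum>j\<le>Suc n. T j (Suc n - j) * w (M j (Suc n - j)))
      = (\<Sum>j\<le>Suc n. h1 j (Suc n - j) + h2 j (Suc n - j))"
    unfolding sum_distrib_left
  proof (rule sum.cong[OF refl])
    fix j assume "j \<in> {..Suc n}"
    thus "(1 - (q ^ 6) ^ Suc n) * (1 - r * (q ^ 6) ^ Suc n) * (T j (Suc n - j) * w (M j (Suc n - j)))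
      = h1 j (Suc n - j) + h2 j (Suc n - j)"
      using split[of j "Suc n - j"] by (simp add: mult_ac)
  qed
  also have "\<dots> = (\<Sum>j\<le>Suc n. h1 j (Suc n - j)) + (\<Sum>j\<le>Suc n. h2 j (Suc n - j))"
    by (rule sum.distrib)
  also have "\<dots> = (\<Sum>j\<le>n. h1 (Suc j) (n - j) + h2 j (Suc (n - j)))"
    by (subst sum_diagonal_shift_left, simp add: h1_def, subst sum_diagonal_shift_right, simp add: h2_def)
       (simp only: sum.distrib)
  also have "\<dots> = (\<Sum>j\<le>n. ((1 + r) * q ^ 6 * ?Y - r * q ^ 6 * (b + \<alpha>) * ?Y\<^sup>2)
      * (T j (n - j) * w (M j (n - j))) + h3 j (n - j))"
  proof (rule sum.cong[OF refl])
    fix j assume "j \<in> {..n}"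
    define k where "k = n - j"
    define X where "X = q ^ (2 * j)"
    define m where "m = M j k"
    have n: "?Y = X * m\<^sup>2"
      using Y[of j k] \<open>j \<in> {..n}\<close> by (simp add: k_def X_def m_def)
    have h3: "h3 j k = T j k * (1 - X) * (X * G m / F j k)"
      by (simp only: h3_def X_def m_def)
    have e1: "h1 (Suc j) k = T j k * X * (q ^ (s + 2) * m\<^sup>2 * f d 3 m * (P (q\<^sup>2 * m) + q\<^sup>2 * X * R (q\<^sup>2 * m))) / F j k"
      unfolding h1_def T_left M_left F_def
      using f_nz[of 1 j k] f_nz[of 2 j k] f_nz[of 3 j k]
      by (simp add: m_def[symmetric] X_def power_add power2_eq_square field_simps)
    have e2: "h2 j (Suc k) = T j k * X * (q ^ (t + 3) * m ^ 3 * (S (q ^ 3 * m) + X * U (q ^ 3 * m))) / F j k"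
      unfolding h2_def T_right M_right
      by (simp add: m_def[symmetric] X_def power2_eq_square field_simps)
    \<comment> \<open>Sorting by powers of \<open>X\<close>: \<open>G\<close> is defined as the
      excess of the constant part over the recurrence, and \<open>cert1\<close> says that the excess
      of the linear part is \<open>- G m\<close>. The remainder therefore has the factor
      \<open>1 - X\<close> needed for another shift.\<close>
    have "q ^ (s + 2) * m\<^sup>2 * f d 3 m * (P (q\<^sup>2 * m) + q\<^sup>2 * X * R (q\<^sup>2 * m))
        + q ^ (t + 3) * m ^ 3 * (S (q ^ 3 * m) + X * U (q ^ 3 * m))
      = (q ^ (s + 2) * m\<^sup>2 * f d 3 m * P (q\<^sup>2 * m) + q ^ (t + 3) * m ^ 3 * S (q ^ 3 * m))
        + X * (q ^ (s + 4) * m\<^sup>2 * f d 3 m * R (q\<^sup>2 * m) + q ^ (t + 3) * m ^ 3 * U (q ^ 3 * m))"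
      by (simp add: power_add power2_eq_square power4_eq_xxxx algebra_simps)
    also have "q ^ (s + 2) * m\<^sup>2 * f d 3 m * P (q\<^sup>2 * m) + q ^ (t + 3) * m ^ 3 * S (q ^ 3 * m)
        = G m + (1 + r) * q ^ 6 * m\<^sup>2 * w m * F j k"
      by (simp add: G_def F_def m_def)
    also have "q ^ (s + 4) * m\<^sup>2 * f d 3 m * R (q\<^sup>2 * m) + q ^ (t + 3) * m ^ 3 * U (q ^ 3 * m)
        = - G m - r * q ^ 6 * (b + \<alpha>) * m ^ 4 * w m * F j k"
      using cert1[of m] by (simp add: F_def m_def algebra_simps)
    finally have e3: "q ^ (s + 2) * m\<^sup>2 * f d 3 m * (P (q\<^sup>2 * m) + q\<^sup>2 * X * R (q\<^sup>2 * m))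
        + q ^ (t + 3) * m ^ 3 * (S (q ^ 3 * m) + X * U (q ^ 3 * m))
      = (1 - X) * G m + ((1 + r) * q ^ 6 * m\<^sup>2 - r * q ^ 6 * (b + \<alpha>) * X * m ^ 4) * w m * F j k"
      by (simp add: algebra_simps)
    have "h1 (Suc j) k + h2 j (Suc k) = T j k * X * ((1 - X) * G m
        + ((1 + r) * q ^ 6 * m\<^sup>2 - r * q ^ 6 * (b + \<alpha>) * X * m ^ 4) * w m * F j k) / F j k"
      unfolding e1 e2 e3[symmetric] by (simp add: add_divide_distrib distrib_left)
    also have "\<dots> = ((1 + r) * q ^ 6 * ?Y - r * q ^ 6 * (b + \<alpha>) * ?Y\<^sup>2) * (T j k * w (M j k)) + h3 j k"
      unfolding n h3 m_def[symmetric] using F_nz[of j k]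
      by (simp add: field_simps power2_eq_square power4_eq_xxxx)
    finally show "h1 (Suc j) (n - j) + h2 j (Suc (n - j)) =
        ((1 + r) * q ^ 6 * ?Y - r * q ^ 6 * (b + \<alpha>) * ?Y\<^sup>2) * (T j (n - j) * w (M j (n - j))) + h3 j (n - j)"
      unfolding k_def .
  qed
  also have "\<dots> = ((1 + r) * q ^ 6 * ?Y - r * q ^ 6 * (b + \<alpha>) * ?Y\<^sup>2) * (\<Sum>j\<le>n. T j (n - j) * w (M j (n - j)))
      + (\<Sum>j\<le>n. h3 j (n - j))"
    by (simp only: sum.distrib sum_distrib_left)
  also have "(\<Sum>j\<le>n. h3 j (n - j)) = - (if n = 0 then 0
      else r * q ^ 6 * ?Y\<^sup>2 * (\<Sum>j\<le>n - 1. T j (n - 1 - j) * w (M j (n - 1 - j))))"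
  proof (cases n)
    case (Suc n')
    have "(\<Sum>j\<le>n. h3 j (n - j)) = (\<Sum>j\<le>n'. h3 (Suc j) (n' - j))"
      unfolding Suc by (rule sum_diagonal_shift_left) (simp add: h3_def)
    also have "\<dots> = (\<Sum>j\<le>n'. - (r * q ^ 6 * ?Y\<^sup>2) * (T j (n' - j) * w (M j (n' - j))))"
    proof (rule sum.cong[OF refl])
      fix j assume "j \<in> {..n'}"
      define k where "k = n' - j"
      define m where "m = M j k"
      define X where "X = q ^ (2 * j)"
      \<comment> \<open>Here \<open>j + k = n - 1\<close>, so \<open>?Y\<close> has an extra
        \<open>q ^ 6\<close>; squaring it and multiplying by \<open>r * q ^ 6\<close> gives the
        constant \<open>r * q ^ 18\<close> of \<open>cert2\<close>.\<close>
      have n: "?Y = q ^ 6 * (X * m\<^sup>2)"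
        using Y[of j k] \<open>j \<in> {..n'}\<close> by (simp add: k_def Suc m_def X_def)
      have "F (Suc j) k = f d 3 m * f d 4 m * f d 5 m"
        by (simp only: F_def M_left f_shift m_def)
      hence "h3 (Suc j) k = T j k * X\<^sup>2 * m\<^sup>2 * (q ^ (s + 4) * G (q\<^sup>2 * m))
          / (f d 1 m * f d 2 m * f d 3 m * f d 4 m * f d 5 m)"
        unfolding h3_def T_left M_left
        by (simp add: m_def[symmetric] X_def power_add power2_eq_square power4_eq_xxxx mult_ac)
      also have "\<dots> = - (r * q ^ 6 * ?Y\<^sup>2) * (T j k * w m)"
        unfolding cert2 n using f_nz[of _ j k, folded m_def]
        by (simp add: power_mult_distrib power_mult[symmetric] mult_ac)
      finally show "h3 (Suc j) (n' - j) = - (r * q ^ 6 * ?Y\<^sup>2) * (T j (n' - j) * w (M j (n' - j)))"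
        by (simp only: k_def m_def)
    qed
    also have "\<dots> = - (r * q ^ 6 * ?Y\<^sup>2 * (\<Sum>j\<le>n'. T j (n' - j) * w (M j (n' - j))))"
      by (simp only: mult_minus_left sum_negf sum_distrib_left)
    finally show ?thesis by (simp only: Suc nat.distinct if_False diff_Suc_1)
  qed (simp add: h3_def)
  finally show "(1 - (q ^ 6) ^ Suc n) * (1 - r * (q ^ 6) ^ Suc n)
      * (\<Sum>j\<le>Suc n. pterm q d s t j (Suc n - j) * w (q ^ (2 * j + 3 * (Suc n - j)))) =
    ((1 + r) * q ^ 6 * ?Y - r * q ^ 6 * (b + \<alpha>) * ?Y\<^sup>2)
      * (\<Sum>j\<le>n. pterm q d s t j (n - j) * w (q ^ (2 * j + 3 * (n - j))))
    - (if n = 0 then 0 else r * q ^ 6 * ?Y\<^sup>2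
      * (\<Sum>j\<le>n - 1. pterm q d s t j (n - 1 - j) * w (q ^ (2 * j + 3 * (n - 1 - j)))))"
    unfolding T_def M_def by simp
qed

lemma kummer_rec_second:
  assumes q: "norm q < 1"
  shows "kummer_rec (q ^ 6) (q ^ 5) q (q ^ 4)
    (\<lambda>n. \<Sum>j\<le>n. pterm q 2 4 7 j (n - j) * (1 + q + q\<^sup>2 * q ^ (2 * j + 3 * (n - j))))"
proof (rule kummer_rec_diagonal[OF q, where w = "\<lambda>m. 1 + q + q\<^sup>2 * m" and
    S = "\<lambda>m. (1 + q - q\<^sup>2 - q ^ 3) - (q ^ 3 + 2 * q ^ 4 + q ^ 5) * m
      - (q + q\<^sup>2 + q ^ 3 + 2 * q ^ 4 + 2 * q ^ 5 + q ^ 6) * m\<^sup>2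
      - (q\<^sup>2 + q ^ 3 + q ^ 4 + q ^ 5 + q ^ 6) * m ^ 3 - q ^ 4 * m ^ 4"], goal_cases)
  case (1 m) show ?case by (simp add: power_add[symmetric]) algebra
next
  case (2 m) show ?case by (simp add: power_add[symmetric]) algebra
qed

text \<open>This concerns the replacement series of the first identity. Since
  \<open>b = 1 / q\<close>, negative powers of \<open>q\<close> also enter the certificate
  \<open>S\<close>.\<close>

lemma kummer_rec_first:
  assumes q: "norm q < 1" "q \<noteq> 0"
  shows "kummer_rec (q ^ 6) (q ^ 7) (1 / q) (q\<^sup>2)
    (\<lambda>n. \<Sum>j\<le>n. pterm q 1 4 5 j (n - j) * (1 + (q + q\<^sup>2) * q ^ (2 * j + 3 * (n - j))))"
proof -
  \<comment> \<open>With \<open>p\<close> as a separate variable, the certificates are polynomial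
    identities modulo \<open>p * q = 1\<close>.\<close>
  define p where "p = 1 / q"
  have p: "p * q = 1" using q by (simp add: p_def)
  show ?thesis unfolding p_def[symmetric]
  proof (rule kummer_rec_diagonal[OF q(1), where w = "\<lambda>m. 1 + (q + q\<^sup>2) * m" and
      S = "\<lambda>m. (q\<^sup>2 - p - p\<^sup>2 - p ^ 3) * m
        + (q ^ 3 - 1 - 2 * p - 2 * p\<^sup>2 - 2 * p ^ 3 - p ^ 4) * m\<^sup>2
        - (p ^ 4 + 2 * p ^ 3 + 2 * p\<^sup>2 + p + 1) * m ^ 3 - (p ^ 3 + p\<^sup>2) * m ^ 4"], goal_cases)
    case (1 m)
    show ?case using p by (simp add: power_add[symmetric]) algebra
  next
    case (2 m)
    show ?case using p by (simp add: power_add[symmetric]) algebra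
  qed
qed

section \<open>Summation of the triple series\<close>

text \<open>Unconditional summability permits summing over \<open>i\<close> inside and then grouping
  the pairs by \<open>j + k = n\<close> into finite blocks.\<close>

lemma triple_diagonal_sums:
  fixes f :: "nat \<times> nat \<times> nat \<Rightarrow> complex"
  assumes f: "f summable_on UNIV" and h: "\<And>j k. (\<lambda>i. f (i, j, k)) sums h j k"
  shows "(\<lambda>n. \<Sum>j\<le>n. h j (n - j)) sums infsum f UNIV"
proof -
  have swap: "((\<lambda>(jk, i). f (i, jk)) has_sum infsum f UNIV) (UNIV \<times> UNIV)"
    using has_sum_infsum[OF f] has_sum_swap[of f UNIV UNIV] by simp
  have inner: "((\<lambda>i. f (i, jk)) has_sum (case jk of (j, k) \<Rightarrow> h j k)) UNIV" for jk
  proof -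
    have "f summable_on range (\<lambda>i. (i, jk))"
      by (rule summable_on_subset_banach[OF f]) simp
    hence "(\<lambda>i. f (i, jk)) summable_on UNIV"
      by (subst (asm) summable_on_reindex) (simp_all add: inj_on_def o_def)
    then obtain s where s: "((\<lambda>i. f (i, jk)) has_sum s) UNIV" by (auto simp: summable_on_def)
    obtain j k where jk: "jk = (j, k)" by (cases jk)
    have "s = h j k"
      using has_sum_imp_sums[OF s] h[of j k] unfolding jk by (rule sums_unique2)
    thus ?thesis using s by (simp add: jk)
  qed
  have "((\<lambda>(j, k). h j k) has_sum infsum f UNIV) UNIV"
    by (rule has_sum_SigmaD[OF swap]) (use inner in simp)
  moreover have "((\<lambda>(n, j). h j (n - j)) has_sum s) (SIGMA n:UNIV. {..n})
      \<longleftrightarrow> ((\<lambda>(j, k). h j k) has_sum s) UNIV" for s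
    by (rule has_sum_reindex_bij_witness[where j = "\<lambda>(n, j). (j, n - j)" and i = "\<lambda>(j, k). (j + k, j)"]) auto
  ultimately have diag: "((\<lambda>(n, j). h j (n - j)) has_sum infsum f UNIV) (SIGMA n:UNIV. {..n})"
    by simp
  have "((\<lambda>n. \<Sum>j\<le>n. h j (n - j)) has_sum infsum f UNIV) UNIV"
  proof (rule has_sum_SigmaD[OF diag])
    show "((\<lambda>j. case (n, j) of (n, j) \<Rightarrow> h j (n - j)) has_sum (\<Sum>j\<le>n. h j (n - j))) {..n}" for n
      using has_sum_finite[of "{..n}" "\<lambda>j. h j (n - j)"] by simp
  qed
  thus ?thesis by (rule has_sum_imp_sums)
qed

lemma triple_has_sum:
  fixes f :: "nat \<times> nat \<times> nat \<Rightarrow> complex"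
  assumes "f summable_on UNIV" "\<And>j k. (\<lambda>i. f (i, j, k)) sums h j k"
    and "(\<lambda>n. \<Sum>j\<le>n. h j (n - j)) sums s"
  shows "(f has_sum s) UNIV"
proof -
  have "infsum f UNIV = s"
    by (rule sums_unique2[OF triple_diagonal_sums[OF assms(1,2)] assms(3)])
  thus ?thesis using has_sum_infsum[OF assms(1)] by simp
qed

section \<open>Absolute convergence and the sum over i\<close>

lemma qpoch_inverse_bounded:
  assumes "norm a < 1" "norm p < 1"
  obtains K where "K > 0" "\<And>n. norm (inverse (qpoch a p n)) \<le> K"
proof -
  have "(\<lambda>n. inverse (qpoch a p n)) \<longlonglongrightarrow> inverse (qpoch_inf a p)"
    by (intro tendsto_inverse qpoch_tendsto qpoch_inf_nonzero assms)
  hence "Bseq (\<lambda>n. inverse (qpoch a p n))"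
    by (rule convergent_imp_Bseq[OF convergentI])
  thus ?thesis using that by (auto simp: Bseq_def)
qed

text \<open>Numerators and reciprocal denominators are bounded, so a constant multiple of
  \<open>norm q ^ (i + j + k)\<close> dominates.\<close>

lemma summable_on_triple:
  fixes q :: complex and N :: "nat \<Rightarrow> nat \<Rightarrow> nat \<Rightarrow> complex" and E :: "nat \<Rightarrow> nat \<Rightarrow> nat \<Rightarrow> nat"
  assumes q: "norm q < 1" and N: "\<And>i j k. norm (N i j k) \<le> B"
    and E: "\<And>i j k. i + (j + k) \<le> E i j k"
  shows "(\<lambda>(i, j, k). N i j k * q ^ E i j k
    / (qpoch q q i * qpoch (q\<^sup>2) (q\<^sup>2) j * qpoch (q ^ 3) (q ^ 3) k)) summable_on UNIV"
proof -
  have p2: "norm (q\<^sup>2) < 1" and p3: "norm (q ^ 3) < 1"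
    by (rule norm_power_pos_lt_1[OF q], simp)+
  obtain K1 where K1: "K1 > 0" "\<And>n. norm (inverse (qpoch q q n)) \<le> K1"
    using qpoch_inverse_bounded[OF q q] by blast
  obtain K2 where K2: "K2 > 0" "\<And>n. norm (inverse (qpoch (q\<^sup>2) (q\<^sup>2) n)) \<le> K2"
    using qpoch_inverse_bounded[OF p2 p2] by blast
  obtain K3 where K3: "K3 > 0" "\<And>n. norm (inverse (qpoch (q ^ 3) (q ^ 3) n)) \<le> K3"
    using qpoch_inverse_bounded[OF p3 p3] by blast
  have B: "B \<ge> 0" using N[of 0 0 0] norm_ge_zero order_trans by blast
  let ?r = "norm q"
  have geo: "(\<lambda>i. ?r ^ i) summable_on UNIV"
    by (rule norm_summable_imp_summable_on) (simp add: q summable_geometric)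
  have "(\<lambda>(j, k). ?r ^ j * ?r ^ k) summable_on UNIV"
    by (rule summable_on_prod_bound[OF _ geo geo]) auto
  hence jk: "(\<lambda>jk. B * K1 * K2 * K3 * (case jk of (j, k) \<Rightarrow> ?r ^ j * ?r ^ k)) summable_on UNIV"
    by (rule summable_on_cmult_right)
  have "(\<lambda>(i, jk). case jk of (j, k) \<Rightarrow> N i j k * q ^ E i j k
      / (qpoch q q i * qpoch (q\<^sup>2) (q\<^sup>2) j * qpoch (q ^ 3) (q ^ 3) k)) summable_on UNIV"
  proof (rule summable_on_prod_bound[OF _ geo jk])
    fix i :: nat and jk :: "nat \<times> nat"
    obtain j k where jk: "jk = (j, k)" by (cases jk)
    have "norm (N i j k * q ^ E i j k
        / (qpoch q q i * qpoch (q\<^sup>2) (q\<^sup>2) j * qpoch (q ^ 3) (q ^ 3) k))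
      = norm (N i j k) * ?r ^ E i j k * norm (inverse (qpoch q q i))
        * norm (inverse (qpoch (q\<^sup>2) (q\<^sup>2) j)) * norm (inverse (qpoch (q ^ 3) (q ^ 3) k))"
      by (simp add: norm_mult norm_divide norm_power norm_inverse divide_inverse mult_ac)
    also have "\<dots> \<le> B * ?r ^ (i + (j + k)) * K1 * K2 * K3"
      by (intro mult_mono K1(2) K2(2) K3(2) N power_decreasing E mult_nonneg_nonneg)
         (use q B K1(1) K2(1) in auto)
    finally show "norm (case jk of (j, k) \<Rightarrow> N i j k * q ^ E i j k
      / (qpoch q q i * qpoch (q\<^sup>2) (q\<^sup>2) j * qpoch (q ^ 3) (q ^ 3) k))
      \<le> ?r ^ i * (B * K1 * K2 * K3 * (case jk of (j, k) \<Rightarrow> ?r ^ j * ?r ^ k))"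
      by (simp add: jk power_add mult_ac)
  qed (use B K1(1) K2(1) K3(1) in \<open>auto split: prod.splits\<close>)
  thus ?thesis by (simp add: case_prod_unfold)
qed

text \<open>Since (i + M choose 2) splits into both binomials plus i M, this is Euler's series at z
  = q^(M+d+1); its product is the tail of \<open>(-q; q)\<close> after M + d factors.\<close>

lemma euler_inner_sums:
  assumes q: "norm q < 1"
  shows "(\<lambda>i. c * q ^ (((i + M) choose 2) + Suc d * i) / qpoch q q i) sums
    (qpoch_inf (- q) q * (c * q ^ (M choose 2) / qpoch (- q) q (M + d)))"
proof -
  have z: "norm (q * q ^ (M + d)) < 1" by (rule norm_mult_power_lt_1[OF q q])
  have "qpoch (- q) q (M + d) \<noteq> 0" by (rule qpoch_nonzero) (simp_all add: q)
  hence *: "qpoch_inf (- (q * q ^ (M + d))) q = qpoch_inf (- q) q / qpoch (- q) q (M + d)"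
    using qpoch_inf_split[OF q, of "- q" "M + d"] by (simp add: field_simps)
  have 1: "(\<lambda>i. c * q ^ (M choose 2) * (q ^ (i choose 2) * (q * q ^ (M + d)) ^ i / qpoch q q i)) sums
      (c * q ^ (M choose 2) * qpoch_inf (- (q * q ^ (M + d))) q)"
    by (intro sums_mult euler_sums q z)
  have 2: "c * q ^ (M choose 2) * (q ^ (i choose 2) * (q * q ^ (M + d)) ^ i / qpoch q q i)
      = c * q ^ (((i + M) choose 2) + Suc d * i) / qpoch q q i" for i
  proof -
    have "(q * q ^ (M + d)) ^ i = q ^ (Suc (M + d) * i)" by (simp only: power_Suc[symmetric] power_mult)
    moreover have "((i + M) choose 2) + Suc d * i = (M choose 2) + ((i choose 2) + Suc (M + d) * i)"
      by (simp add: choose_two_add algebra_simps)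
    ultimately show ?thesis by (simp only: power_add) (simp add: mult_ac)
  qed
  show ?thesis using 1 unfolding 2 * by (simp add: mult_ac)
qed

section \<open>Values of the double series\<close>

lemma kummer_sum_second:
  assumes q: "norm q < 1"
  shows "(\<lambda>n. \<Sum>j\<le>n. pterm q 2 4 7 j (n - j) * (1 + q + q\<^sup>2 * q ^ (2 * j + 3 * (n - j)))) sums
    ((1 + q + q\<^sup>2) / ((1 + q) * (1 + q\<^sup>2)) * (qpoch_inf (- (q ^ 6)) (q ^ 6)
      * qpoch_inf (q ^ 11) (q ^ 12) * qpoch_inf (q ^ 15) (q ^ 12) / qpoch_inf (q ^ 10) (q ^ 6)))"
proof -
  have pw: "norm (q ^ 6) < 1" "norm (q ^ 5) < 1" "norm (q ^ 4) < 1"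
    by (rule norm_power_pos_lt_1[OF q], simp)+
  have *: "q ^ 4 * q = q ^ 5" "q * q ^ 5 = q ^ 6" "q ^ 5 * q ^ 6 = q ^ 11" "q ^ 4 * q ^ 5 * q ^ 6 = q ^ 15"
    "q ^ 4 * q ^ 6 = q ^ 10" "(q ^ 6)\<^sup>2 = q ^ 12"
    by (simp_all add: eval_nat_numeral)
  have 0: "(\<Sum>j\<le>0. pterm q 2 4 7 j (0 - j) * (1 + q + q\<^sup>2 * q ^ (2 * j + 3 * (0 - j))))
      = (1 + q + q\<^sup>2) / ((1 + q) * (1 + q\<^sup>2))"
    by (simp add: pterm_def numeral_2_eq_2 qpoch_Suc)
  show ?thesis
    using kummer_rec_sums[OF pw(1) pw(2) pw(3) _ *(2) kummer_rec_second[OF q]] pw(2) unfolding 0 * by blast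
qed

text \<open>The parameter \<open>b = 1 / q\<close> lies outside the unit disc;
  \<open>kummer_rec_sums\<close> bounds only \<open>r * b\<close>, which is \<open>q\<close>. The
  leading quotient is the diagonal sum for n = 0.\<close>

lemma kummer_sum_first:
  assumes q: "norm q < 1" "q \<noteq> 0"
  shows "(\<lambda>n. \<Sum>j\<le>n. pterm q 1 4 5 j (n - j) * (1 + (q + q\<^sup>2) * q ^ (2 * j + 3 * (n - j)))) sums
    ((1 + q + q\<^sup>2) / (1 + q) * (qpoch_inf (- (q ^ 6)) (q ^ 6)
      * qpoch_inf (q ^ 7) (q ^ 12) * qpoch_inf (q ^ 15) (q ^ 12) / qpoch_inf (q ^ 8) (q ^ 6)))"
proof -
  have pw: "norm (q ^ 6) < 1" "norm (q ^ 7) < 1" "norm (q\<^sup>2) < 1"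
    by (rule norm_power_pos_lt_1[OF q(1)], simp)+
  have *: "q\<^sup>2 * (1 / q) = q" "1 / q * q ^ 7 = q ^ 6" "q * q ^ 6 = q ^ 7" "q\<^sup>2 * q ^ 7 * q ^ 6 = q ^ 15"
    "q\<^sup>2 * q ^ 6 = q ^ 8" "(q ^ 6)\<^sup>2 = q ^ 12"
    using q(2) by (simp_all add: eval_nat_numeral)
  have 0: "(\<Sum>j\<le>0. pterm q 1 4 5 j (0 - j) * (1 + (q + q\<^sup>2) * q ^ (2 * j + 3 * (0 - j))))
      = (1 + q + q\<^sup>2) / (1 + q)"
    by (simp add: pterm_def qpoch_Suc add.assoc binomial_eq_0)
  show ?thesis
    using kummer_rec_sums[OF pw(1) pw(2) pw(3) _ *(2) kummer_rec_first[OF q]] q(1) unfolding 0 * by blast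
qed

text \<open>
  Telescoping along the diagonals: with \<open>a\<^sub>n\<close> the \<open>n\<close>-th diagonal sum of \<open>pterm q 0 2 2 j k (1 - m)\<close>,
  \<open>m = q\<^sup>2\<^sup>j\<^sup>+\<^sup>3\<^sup>k\<close>, the diagonal sums of the two double series differ by \<open>a\<^sub>n - a\<^sub>n\<^sub>+\<^sub>1\<close>.
\<close>
lemma diagonal_sum_first:
  fixes q :: complex
  defines "m \<equiv> \<lambda>j k. q ^ (2 * j + 3 * k)"
  defines "h \<equiv> \<lambda>j k. pterm q 0 2 2 j k * (1 + q\<^sup>2 * (m j k)\<^sup>2 / ((1 + q * m j k) * (1 + q\<^sup>2 * m j k))
      - q ^ 5 * (m j k) ^ 3 / ((1 + q * m j k) * (1 + q\<^sup>2 * m j k) * (1 + q ^ 3 * m j k)))"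
  defines "a \<equiv> \<lambda>n. \<Sum>j\<le>n. pterm q 0 2 2 j (n - j) * (1 - m j (n - j))"
  assumes q: "norm q < 1"
    and a: "summable a"
    and s: "(\<lambda>n. \<Sum>j\<le>n. pterm q 1 4 5 j (n - j) * (1 + (q + q\<^sup>2) * m j (n - j))) sums s"
  shows "(\<lambda>n. \<Sum>j\<le>n. h j (n - j)) sums s"
proof -
  \<comment> \<open>These split the summand of \<open>a\<close> by 1 - X V = (1 - X) V + (1 - V)
    with X = \<open>q ^ (2 * j)\<close> and V = \<open>q ^ (3 * k)\<close>, so that each part can be
    shifted to the previous diagonal.\<close>
  define h1 where "h1 = (\<lambda>j k. pterm q 0 2 2 j k * (1 - q ^ (2 * j)) * q ^ (3 * k))"
  define h2 where "h2 = (\<lambda>j k. pterm q 0 2 2 j k * (1 - q ^ (3 * k)))"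
  have nz: "1 + q * m j k \<noteq> 0" "1 + q\<^sup>2 * m j k \<noteq> 0" "1 + q ^ 3 * m j k \<noteq> 0" for j k
    using one_plus_power_nonzero[OF q, of _ "2 * j + 3 * k"] unfolding m_def
    by (metis power_one_right zero_less_one, simp_all)
  have m_split: "m j k = q ^ (2 * j) * q ^ (3 * k)" for j k
    by (simp add: m_def power_add)
  \<comment> \<open>After multiplication by \<open>pterm q 0 2 2 j k\<close>, the right-hand terms
    are the replacement summand, the summand of \<open>a\<close>, and minus
    \<open>h1 (Suc j) k\<close>. The remaining cubic term of \<open>h\<close> is minus
    \<open>h2 j (Suc k)\<close>.\<close>
  have key: "1 + q\<^sup>2 * x\<^sup>2 / ((1 + q * x) * (1 + q\<^sup>2 * x))
      = x * (1 + (q + q\<^sup>2) * x) / (1 + q * x) + (1 - x) - q ^ 4 * x ^ 3 / ((1 + q * x) * (1 + q\<^sup>2 * x))"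
    if "1 + q * x \<noteq> 0" "1 + q\<^sup>2 * x \<noteq> 0" for x
    using that by (simp add: divide_simps) algebra
  have p145: "pterm q 1 4 5 j k = pterm q 0 2 2 j k * m j k / (1 + q * m j k)" for j k
  proof -
    have "((2 * j + 3 * k) choose 2) + j\<^sup>2 + 4 * j + 5 * k
        = (((2 * j + 3 * k) choose 2) + j\<^sup>2 + 2 * j + 2 * k) + (2 * j + 3 * k)" by simp
    hence "q ^ (((2 * j + 3 * k) choose 2) + j\<^sup>2 + 4 * j + 5 * k)
        = q ^ (((2 * j + 3 * k) choose 2) + j\<^sup>2 + 2 * j + 2 * k) * m j k"
      unfolding m_def by (simp only: power_add)
    moreover have "qpoch (- q) q (2 * j + 3 * k + 1) = qpoch (- q) q (2 * j + 3 * k + 0) * (1 + q * m j k)"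
      by (simp add: qpoch_Suc m_def)
    ultimately show ?thesis unfolding pterm_def by simp
  qed
  have h1_Suc: "h1 (Suc j) k = pterm q 0 2 2 j k * (q ^ 4 * (m j k) ^ 3 / ((1 + q * m j k) * (1 + q\<^sup>2 * m j k)))" for j k
  proof -
    have "pterm q 0 2 2 (Suc j) k * (1 - q ^ (2 * Suc j)) = pterm q 0 2 2 j k
        * (q ^ 4 * (m j k)\<^sup>2 * q ^ (2 * j)) / ((1 + q * m j k) * (1 + q\<^sup>2 * m j k))"
      using pterm_Suc_left[OF q, of 0 2 2 j k] by (simp add: m_def power2_eq_square)
    moreover have "(m j k) ^ 3 = (m j k)\<^sup>2 * (q ^ (2 * j) * q ^ (3 * k))"
      by (simp only: m_split[symmetric] power3_eq_cube power2_eq_square)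
    ultimately show ?thesis unfolding h1_def by (simp only: times_divide_eq_left times_divide_eq_right mult_ac)
  qed
  have h2_Suc: "h2 j (Suc k) = pterm q 0 2 2 j k
      * (q ^ 5 * (m j k) ^ 3 / ((1 + q * m j k) * (1 + q\<^sup>2 * m j k) * (1 + q ^ 3 * m j k)))" for j k
    using pterm_Suc_right[OF q, of 0 2 2 j k] by (simp add: h2_def m_def power2_eq_square)
  have "(\<Sum>j\<le>n. h j (n - j)) = (\<Sum>j\<le>n. pterm q 1 4 5 j (n - j) * (1 + (q + q\<^sup>2) * m j (n - j)))
      - (a (Suc n) - a n)" for n
  proof -
    have "a (Suc n) = (\<Sum>j\<le>Suc n. h1 j (Suc n - j)) + (\<Sum>j\<le>Suc n. h2 j (Suc n - j))"
      unfolding a_def h1_def h2_def sum.distrib[symmetric]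
      by (rule sum.cong[OF refl]) (simp only: m_split, simp add: algebra_simps)
    also have "\<dots> = (\<Sum>j\<le>n. h1 (Suc j) (n - j) + h2 j (Suc (n - j)))"
      by (subst sum_diagonal_shift_left, simp add: h1_def, subst sum_diagonal_shift_right, simp add: h2_def)
         (simp only: sum.distrib)
    finally have a_Suc: "a (Suc n) = (\<Sum>j\<le>n. h1 (Suc j) (n - j) + h2 j (Suc (n - j)))" .
    have "h j k = pterm q 1 4 5 j k * (1 + (q + q\<^sup>2) * m j k)
        - (h1 (Suc j) k + h2 j (Suc k) - pterm q 0 2 2 j k * (1 - m j k))" for j k
      unfolding h_def h1_Suc h2_Suc p145 key[OF nz(1,2)] by (simp add: algebra_simps)
    hence "(\<Sum>j\<le>n. h j (n - j)) = (\<Sum>j\<le>n. pterm q 1 4 5 j (n - j) * (1 + (q + q\<^sup>2) * m j (n - j))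
        - (h1 (Suc j) (n - j) + h2 j (Suc (n - j)) - pterm q 0 2 2 j (n - j) * (1 - m j (n - j))))"
      by (simp only:)
    moreover have "a n = (\<Sum>j\<le>n. pterm q 0 2 2 j (n - j) * (1 - m j (n - j)))"
      by (simp only: a_def)
    ultimately show ?thesis using a_Suc by (simp only: sum_subtractf)
  qed
  moreover have "(\<lambda>n. a (Suc n) - a n) sums (0 - a 0)"
    by (rule telescope_sums[OF summable_LIMSEQ_zero[OF a]])
  moreover have "a 0 = 0" by (simp add: a_def m_def)
  ultimately show ?thesis using sums_diff[OF s, of "\<lambda>n. a (Suc n) - a n" 0] by simp
qed

section \<open>Infinite products modulo 12\<close>

lemma one_minus_factor:
  fixes q :: complex
  shows "(1 - q) * (1 + q + q\<^sup>2) = 1 - q ^ 3"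
    and "(1 - q) * ((1 + q) * (1 + q\<^sup>2)) = 1 - q ^ 4" and "(1 - q) * (1 + q) = 1 - q\<^sup>2"
  by algebra+

lemma qpoch_inf_mod_6:
  assumes q: "norm q < 1"
  shows "qpoch_inf a (q ^ 6) = qpoch_inf a (q ^ 12) * qpoch_inf (a * q ^ 6) (q ^ 12)"
proof -
  have "(q ^ 6)\<^sup>2 = q ^ 12" by simp
  thus ?thesis using qpoch_inf_even_odd[OF norm_power_pos_lt_1[OF q], of 6 a] by simp
qed

lemma qpoch_inf_mod_3:
  assumes q: "norm q < 1"
  shows "qpoch_inf a (q ^ 3) = qpoch_inf a (q ^ 6) * qpoch_inf (a * q ^ 3) (q ^ 6)"
proof -
  have "(q ^ 3)\<^sup>2 = q ^ 6" by simp
  thus ?thesis using qpoch_inf_even_odd[OF norm_power_pos_lt_1[OF q], of 3 a] by simp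
qed

lemma qpoch_inf_odd_mod_12:
  assumes q: "norm q < 1"
  shows "qpoch_inf q (q\<^sup>2) = qpoch_inf q (q ^ 12) * qpoch_inf (q ^ 3) (q ^ 12) * qpoch_inf (q ^ 5) (q ^ 12)
    * qpoch_inf (q ^ 7) (q ^ 12) * qpoch_inf (q ^ 9) (q ^ 12) * qpoch_inf (q ^ 11) (q ^ 12)"
proof -
  have q2: "norm (q\<^sup>2) < 1" by (rule norm_power_pos_lt_1[OF q]) simp
  have "(\<Prod>r<6. qpoch_inf (q * (q\<^sup>2) ^ r) ((q\<^sup>2) ^ 6)) = (\<Prod>r<6. qpoch_inf (q ^ (2 * r + 1)) (q ^ 12))"
    by (simp add: power_mult[symmetric])
  thus ?thesis using qpoch_inf_dissect[OF q2, of 6 q] by (simp add: lessThan_Suc eval_nat_numeral mult_ac)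
qed

lemma qpoch_inf_minus_mod_12:
  assumes q: "norm q < 1"
  shows "qpoch_inf (- q) q = 1 / (qpoch_inf q (q ^ 12) * qpoch_inf (q ^ 3) (q ^ 12) * qpoch_inf (q ^ 5) (q ^ 12)
      * qpoch_inf (q ^ 7) (q ^ 12) * qpoch_inf (q ^ 9) (q ^ 12) * qpoch_inf (q ^ 11) (q ^ 12))"
    and "qpoch_inf (- (q ^ 6)) (q ^ 6) = 1 / qpoch_inf (q ^ 6) (q ^ 12)"
proof -
  have eq: "x = 1 / y" if "x * y = 1" for x y :: complex
    using that by (metis nonzero_eq_divide_eq mult_zero_right zero_neq_one)
  show "qpoch_inf (- q) q = 1 / (qpoch_inf q (q ^ 12) * qpoch_inf (q ^ 3) (q ^ 12) * qpoch_inf (q ^ 5) (q ^ 12)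
      * qpoch_inf (q ^ 7) (q ^ 12) * qpoch_inf (q ^ 9) (q ^ 12) * qpoch_inf (q ^ 11) (q ^ 12))"
    by (rule eq) (use qpoch_inf_minus_mult_odd[OF q] in \<open>simp only: qpoch_inf_odd_mod_12[OF q]\<close>)
  have "(q ^ 6)\<^sup>2 = q ^ 12" by simp
  thus "qpoch_inf (- (q ^ 6)) (q ^ 6) = 1 / qpoch_inf (q ^ 6) (q ^ 12)"
    using qpoch_inf_minus_mult_odd[OF norm_power_pos_lt_1[OF q], of 6] by (intro eq) simp
qed

text \<open>The prefactor equals (1 - q^3)/(1 - q^4) and moves the products starting at q^15 and
  q^10 back to q^3 and q^4. Cancelling residues 3 and 11 leaves 1 and 7 modulo 12 and 4 modulo 6,
  that is 1 modulo 3, besides 5, 6, 9.\<close>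

lemma product_second:
  fixes q :: complex
  assumes q: "norm q < 1"
  shows "qpoch_inf (- q) q * ((1 + q + q\<^sup>2) / ((1 + q) * (1 + q\<^sup>2)) * (qpoch_inf (- (q ^ 6)) (q ^ 6)
      * qpoch_inf (q ^ 11) (q ^ 12) * qpoch_inf (q ^ 15) (q ^ 12) / qpoch_inf (q ^ 10) (q ^ 6)))
    = 1 / (qpoch_inf q (q ^ 3)
      * (qpoch_inf (q ^ 5) (q ^ 12) * qpoch_inf (q ^ 6) (q ^ 12) * qpoch_inf (q ^ 9) (q ^ 12)))"
proof -
  have pos: "norm (q ^ n) < 1" if "0 < n" for n using norm_power_pos_lt_1[OF q that] .
  have g: "qpoch_inf q (q ^ 12) \<noteq> 0" "qpoch_inf (q ^ 3) (q ^ 12) \<noteq> 0" "qpoch_inf (q ^ 7) (q ^ 12) \<noteq> 0"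
    "qpoch_inf (q ^ 11) (q ^ 12) \<noteq> 0" "qpoch_inf (q ^ 4) (q ^ 6) \<noteq> 0"
    by (simp_all add: qpoch_inf_nonzero q pos)
  have nz: "1 - q \<noteq> 0" "1 - q ^ 3 \<noteq> 0" "1 - q ^ 4 \<noteq> 0"
    by (rule one_minus_nonzero, simp add: q pos)+
  have g15: "qpoch_inf (q ^ 15) (q ^ 12) = qpoch_inf (q ^ 3) (q ^ 12) / (1 - q ^ 3)"
    using qpoch_inf_head[OF pos[of 12], of "q ^ 3"] nz(2) by (simp add: power_add[symmetric])
  have h10: "qpoch_inf (q ^ 10) (q ^ 6) = qpoch_inf (q ^ 4) (q ^ 6) / (1 - q ^ 4)"
    using qpoch_inf_head[OF pos[of 6], of "q ^ 4"] nz(3) by (simp add: power_add[symmetric])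
  have q3: "qpoch_inf q (q ^ 3) = qpoch_inf q (q ^ 12) * qpoch_inf (q ^ 7) (q ^ 12) * qpoch_inf (q ^ 4) (q ^ 6)"
    using qpoch_inf_mod_3[OF q, of q] qpoch_inf_mod_6[OF q, of q] by (simp flip: power_Suc)
  have w: "(1 + q + q\<^sup>2) / ((1 + q) * (1 + q\<^sup>2)) = (1 - q ^ 3) / (1 - q ^ 4)"
    unfolding one_minus_factor(1,2)[symmetric] using nz(1) by simp
  show ?thesis
    unfolding qpoch_inf_minus_mod_12[OF q] q3 w g15 h10 using g nz(2,3) by simp
qed

text \<open>Now the prefactor is (1 - q^3)/(1 - q^2), and residues 3 and 7 cancel. The classes 5 and
  11 modulo 12 and 2 modulo 6 form 2 modulo 3.\<close>

lemma product_first: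
  fixes q :: complex
  assumes q: "norm q < 1"
  shows "qpoch_inf (- q) q * ((1 + q + q\<^sup>2) / (1 + q) * (qpoch_inf (- (q ^ 6)) (q ^ 6)
      * qpoch_inf (q ^ 7) (q ^ 12) * qpoch_inf (q ^ 15) (q ^ 12) / qpoch_inf (q ^ 8) (q ^ 6)))
    = 1 / (qpoch_inf (q\<^sup>2) (q ^ 3)
      * (qpoch_inf q (q ^ 12) * qpoch_inf (q ^ 6) (q ^ 12) * qpoch_inf (q ^ 9) (q ^ 12)))"
proof -
  have pos: "norm (q ^ n) < 1" if "0 < n" for n using norm_power_pos_lt_1[OF q that] .
  have g: "qpoch_inf (q ^ 3) (q ^ 12) \<noteq> 0" "qpoch_inf (q ^ 5) (q ^ 12) \<noteq> 0" "qpoch_inf (q ^ 7) (q ^ 12) \<noteq> 0"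
    "qpoch_inf (q ^ 11) (q ^ 12) \<noteq> 0" "qpoch_inf (q\<^sup>2) (q ^ 6) \<noteq> 0"
    by (simp_all add: qpoch_inf_nonzero q pos)
  have nz: "1 - q \<noteq> 0" "1 - q ^ 3 \<noteq> 0" "1 - q\<^sup>2 \<noteq> 0"
    by (rule one_minus_nonzero, simp add: q pos)+
  have g15: "qpoch_inf (q ^ 15) (q ^ 12) = qpoch_inf (q ^ 3) (q ^ 12) / (1 - q ^ 3)"
    using qpoch_inf_head[OF pos[of 12], of "q ^ 3"] nz(2) by (simp add: power_add[symmetric])
  have h8: "qpoch_inf (q ^ 8) (q ^ 6) = qpoch_inf (q\<^sup>2) (q ^ 6) / (1 - q\<^sup>2)"
    using qpoch_inf_head[OF pos[of 6], of "q\<^sup>2"] nz(3) by (simp add: power_add[symmetric])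
  have q3: "qpoch_inf (q\<^sup>2) (q ^ 3)
      = qpoch_inf (q\<^sup>2) (q ^ 6) * (qpoch_inf (q ^ 5) (q ^ 12) * qpoch_inf (q ^ 11) (q ^ 12))"
    using qpoch_inf_mod_3[OF q, of "q\<^sup>2"] qpoch_inf_mod_6[OF q, of "q ^ 5"]
    by (simp add: power_add[symmetric])
  have w: "(1 + q + q\<^sup>2) / (1 + q) = (1 - q ^ 3) / (1 - q\<^sup>2)"
    unfolding one_minus_factor(1,3)[symmetric] using nz(1) by simp
  show ?thesis
    unfolding qpoch_inf_minus_mod_12[OF q] q3 w g15 h8 using g nz(2,3) by simp
qed

section \<open>The two identities\<close>

lemma has_sum_second:
  fixes q :: complex
  assumes q: "norm q < 1"
  shows "((\<lambda>(i::nat, j::nat, k::nat).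
            (1 + q + q ^ (2*j + 3*k + 2))
              * q ^ (((i + 2*j + 3*k) choose 2) + 3*i + j^2 + 4*j + 7*k)
              / (qpoch q q i * qpoch (q^2) (q^2) j * qpoch (q^3) (q^3) k))
          has_sum
            1 / (qpoch_inf q (q^3)
                  * (qpoch_inf (q^5) (q^12) * qpoch_inf (q^6) (q^12) * qpoch_inf (q^9) (q^12)))) UNIV"
proof (rule triple_has_sum)
  show "(\<lambda>(i::nat, j::nat, k::nat).
            (1 + q + q ^ (2*j + 3*k + 2))
              * q ^ (((i + 2*j + 3*k) choose 2) + 3*i + j^2 + 4*j + 7*k)
              / (qpoch q q i * qpoch (q^2) (q^2) j * qpoch (q^3) (q^3) k)) summable_on UNIV"
  proof (rule summable_on_triple[OF q])
    show "norm (1 + q + q ^ (2*j + 3*k + 2)) \<le> 3" for j k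
    proof -
      have "norm (1 + q + q ^ (2*j + 3*k + 2)) \<le> norm (1::complex) + norm q + norm (q ^ (2*j + 3*k + 2))"
        by (meson add_right_mono norm_triangle_ineq order_trans)
      moreover have "norm (q ^ (2*j + 3*k + 2)) < 1" by (rule norm_power_pos_lt_1[OF q]) simp
      ultimately show ?thesis using q by simp
    qed
  qed simp
  show "(\<lambda>i. case (i, j, k) of (i, j, k) \<Rightarrow>
            (1 + q + q ^ (2*j + 3*k + 2))
              * q ^ (((i + 2*j + 3*k) choose 2) + 3*i + j^2 + 4*j + 7*k)
              / (qpoch q q i * qpoch (q^2) (q^2) j * qpoch (q^3) (q^3) k))
      sums (qpoch_inf (- q) q * (pterm q 2 4 7 j k * (1 + q + q\<^sup>2 * q ^ (2 * j + 3 * k))))" for j k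
  proof -
    let ?c = "(1 + q + q ^ (2*j + 3*k + 2)) * q ^ (j\<^sup>2 + 4 * j + 7 * k)
      / (qpoch (q\<^sup>2) (q\<^sup>2) j * qpoch (q ^ 3) (q ^ 3) k)"
    have "?c * q ^ (((i + (2 * j + 3 * k)) choose 2) + Suc 2 * i) / qpoch q q i
      = (1 + q + q ^ (2*j + 3*k + 2))
              * q ^ (((i + 2*j + 3*k) choose 2) + 3*i + j^2 + 4*j + 7*k)
              / (qpoch q q i * qpoch (q^2) (q^2) j * qpoch (q^3) (q^3) k)" for i
      by (simp add: power_add add.assoc mult_ac)
    moreover have "?c * q ^ ((2 * j + 3 * k) choose 2) / qpoch (- q) q ((2 * j + 3 * k) + 2)
      = pterm q 2 4 7 j k * (1 + q + q\<^sup>2 * q ^ (2 * j + 3 * k))"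
      unfolding pterm_def by (simp add: power_add power2_eq_square mult_ac)
    ultimately show ?thesis
      using euler_inner_sums[OF q, of ?c "2 * j + 3 * k" 2] by simp
  qed
  show "(\<lambda>n. \<Sum>j\<le>n. qpoch_inf (- q) q * (pterm q 2 4 7 j (n - j) * (1 + q + q\<^sup>2 * q ^ (2 * j + 3 * (n - j)))))
      sums (1 / (qpoch_inf q (q^3)
        * (qpoch_inf (q^5) (q^12) * qpoch_inf (q^6) (q^12) * qpoch_inf (q^9) (q^12))))"
    unfolding sum_distrib_left[symmetric] product_second[OF q, symmetric]
    by (rule sums_mult[OF kummer_sum_second[OF q]])
qed


text \<open>Supplies a null sequence for the telescoping: undoing the sum over \<open>i\<close>
  exhibits these terms, up to the nonzero factor \<open>qpoch_inf (- q) q\<close>, as diagonal sums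
  of an absolutely convergent triple series.\<close>

lemma summable_first_diagonal:
  fixes q :: complex
  assumes q: "norm q < 1"
  shows "summable (\<lambda>n. \<Sum>j\<le>n. pterm q 0 2 2 j (n - j) * (1 - q ^ (2 * j + 3 * (n - j))))"
proof -
  let ?f = "\<lambda>(i, j, k). (1 - q ^ (2 * j + 3 * k)) * q ^ (((i + (2 * j + 3 * k)) choose 2) + Suc 0 * i + j\<^sup>2 + 2 * j + 2 * k)
      / (qpoch q q i * qpoch (q\<^sup>2) (q\<^sup>2) j * qpoch (q ^ 3) (q ^ 3) k)"
  have "?f summable_on UNIV"
  proof (rule summable_on_triple[OF q])
    show "norm (1 - q ^ (2 * j + 3 * k)) \<le> 2" for j k
    proof -
      have "norm (q ^ (2 * j + 3 * k)) \<le> 1" unfolding norm_power by (rule power_le_one) (use q in auto)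
      thus ?thesis using norm_triangle_ineq4[of 1 "q ^ (2 * j + 3 * k)"] by simp
    qed
  qed simp
  moreover have "(\<lambda>i. ?f (i, j, k)) sums
      (qpoch_inf (- q) q * (pterm q 0 2 2 j k * (1 - q ^ (2 * j + 3 * k))))" for j k
  proof -
    let ?c = "(1 - q ^ (2*j + 3*k)) * q ^ (j\<^sup>2 + 2 * j + 2 * k)
      / (qpoch (q\<^sup>2) (q\<^sup>2) j * qpoch (q ^ 3) (q ^ 3) k)"
    have "?c * q ^ (((i + (2 * j + 3 * k)) choose 2) + Suc 0 * i) / qpoch q q i = ?f (i, j, k)" for i
      by (simp add: power_add mult_ac)
    moreover have "?c * q ^ ((2 * j + 3 * k) choose 2) / qpoch (- q) q ((2 * j + 3 * k) + 0)
      = pterm q 0 2 2 j k * (1 - q ^ (2 * j + 3 * k))"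
      unfolding pterm_def by (simp add: power_add mult_ac)
    ultimately show ?thesis
      using euler_inner_sums[OF q, of ?c "2 * j + 3 * k" 0] by simp
  qed
  ultimately have "summable (\<lambda>n. \<Sum>j\<le>n. qpoch_inf (- q) q * (pterm q 0 2 2 j (n - j) * (1 - q ^ (2 * j + 3 * (n - j)))))"
    by (rule sums_summable[OF triple_diagonal_sums])
  moreover have "qpoch_inf (- q) q \<noteq> 0" by (rule qpoch_inf_nonzero) (simp_all add: q)
  ultimately show ?thesis unfolding sum_distrib_left[symmetric] by (rule summable_mult_D)
qed

lemma has_sum_first:
  fixes q :: complex
  assumes q: "norm q < 1" "q \<noteq> 0"
  shows "((\<lambda>(i::nat, j::nat, k::nat).
            (1 + q ^ (2*i + 4*j + 6*k + 2) - q ^ (3*i + 6*j + 9*k + 5))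
              * q ^ (((i + 2*j + 3*k) choose 2) + i + j^2 + 2*j + 2*k)
              / (qpoch q q i * qpoch (q^2) (q^2) j * qpoch (q^3) (q^3) k))
          has_sum
            1 / (qpoch_inf (q^2) (q^3)
                  * (qpoch_inf q (q^12) * qpoch_inf (q^6) (q^12) * qpoch_inf (q^9) (q^12)))) UNIV"
proof (rule triple_has_sum)
  show "(\<lambda>(i::nat, j::nat, k::nat).
            (1 + q ^ (2*i + 4*j + 6*k + 2) - q ^ (3*i + 6*j + 9*k + 5))
              * q ^ (((i + 2*j + 3*k) choose 2) + i + j^2 + 2*j + 2*k)
              / (qpoch q q i * qpoch (q^2) (q^2) j * qpoch (q^3) (q^3) k)) summable_on UNIV"
  proof (rule summable_on_triple[OF q(1)])
    show "norm (1 + q ^ (2*i + 4*j + 6*k + 2) - q ^ (3*i + 6*j + 9*k + 5)) \<le> 3" for i j k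
    proof -
      have "norm (q ^ (2*i + 4*j + 6*k + 2)) < 1" "norm (q ^ (3*i + 6*j + 9*k + 5)) < 1"
        by (rule norm_power_pos_lt_1[OF q(1)], simp)+
      moreover have "norm (1 + x - y) \<le> 1 + norm x + norm y" for x y :: complex
        using norm_triangle_ineq4[of "1 + x" y] norm_triangle_ineq[of 1 x] by simp
      ultimately show ?thesis by (smt (verit))
    qed
  qed simp
  let ?m = "\<lambda>j k. q ^ (2 * j + 3 * k)"
  let ?h = "\<lambda>j k. pterm q 0 2 2 j k * (1 + q\<^sup>2 * (?m j k)\<^sup>2 / ((1 + q * ?m j k) * (1 + q\<^sup>2 * ?m j k))
      - q ^ 5 * (?m j k) ^ 3 / ((1 + q * ?m j k) * (1 + q\<^sup>2 * ?m j k) * (1 + q ^ 3 * ?m j k)))"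
  show "(\<lambda>i. case (i, j, k) of (i, j, k) \<Rightarrow>
            (1 + q ^ (2*i + 4*j + 6*k + 2) - q ^ (3*i + 6*j + 9*k + 5))
              * q ^ (((i + 2*j + 3*k) choose 2) + i + j^2 + 2*j + 2*k)
              / (qpoch q q i * qpoch (q^2) (q^2) j * qpoch (q^3) (q^3) k))
      sums (qpoch_inf (- q) q * ?h j k)" for j k
  proof -
    define D where "D = qpoch (q\<^sup>2) (q\<^sup>2) j * qpoch (q ^ 3) (q ^ 3) k"
    define M where "M = 2 * j + 3 * k"
    define e where "e = q ^ (j\<^sup>2 + 2 * j + 2 * k)"
    have M: "2 * i + 4 * j + 6 * k + 2 = 2 * i + (2 * M + 2)" "3 * i + 6 * j + 9 * k + 5 = 3 * i + (3 * M + 5)"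
      "i + 2 * j + 3 * k = i + M" for i
      by (simp_all add: M_def)
    \<comment> \<open>The three summands of the numerator carry q^0, q^(2i) and q^(3i), hence
      Euler's sum with offsets 0, 2 and 3.\<close>
    have "(\<lambda>i. (e / D) * q ^ (((i + M) choose 2) + Suc 0 * i) / qpoch q q i
        + (e * q ^ (2 * M + 2) / D) * q ^ (((i + M) choose 2) + Suc 2 * i) / qpoch q q i
        - (e * q ^ (3 * M + 5) / D) * q ^ (((i + M) choose 2) + Suc 3 * i) / qpoch q q i)
      sums (qpoch_inf (- q) q * (e / D * q ^ (M choose 2) / qpoch (- q) q (M + 0))
        + qpoch_inf (- q) q * (e * q ^ (2 * M + 2) / D * q ^ (M choose 2) / qpoch (- q) q (M + 2))
        - qpoch_inf (- q) q * (e * q ^ (3 * M + 5) / D * q ^ (M choose 2) / qpoch (- q) q (M + 3)))"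
      by (intro sums_diff sums_add euler_inner_sums q)
    moreover have "(e / D) * q ^ (((i + M) choose 2) + Suc 0 * i) / qpoch q q i
        + (e * q ^ (2 * M + 2) / D) * q ^ (((i + M) choose 2) + Suc 2 * i) / qpoch q q i
        - (e * q ^ (3 * M + 5) / D) * q ^ (((i + M) choose 2) + Suc 3 * i) / qpoch q q i
      = (1 + q ^ (2*i + 4*j + 6*k + 2) - q ^ (3*i + 6*j + 9*k + 5))
              * q ^ (((i + 2*j + 3*k) choose 2) + i + j^2 + 2*j + 2*k)
              / (qpoch q q i * qpoch (q^2) (q^2) j * qpoch (q^3) (q^3) k)" for i
    proof -
      have e': "((i + M) choose 2) + i + j^2 + 2*j + 2*k = ((i + M) choose 2) + (i + (j^2 + 2*j + 2*k))"
        by simp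
      have s: "Suc 0 * i = i" "Suc 2 * i = 2 * i + i" "Suc 3 * i = 3 * i + i" by simp_all
      have "x / D * (b * a) / y + x * c / D * (b * (c' * a)) / y - x * d / D * (b * (d' * a)) / y
        = (1 + c' * c - d' * d) * (b * (a * x)) / (y * D)" for x y a b c d c' d' :: complex
        by (simp only: divide_inverse inverse_mult_distrib algebra_simps mult_1_left)
      thus ?thesis unfolding M e' mult.assoc[of "qpoch q q i"] D_def[symmetric]
        by (simp only: s power_add[of q "(i + M) choose 2"] power_add[of q "2 * i"]
            power_add[of q "3 * i"] power_add[of q i] e_def[symmetric])
    qed
    moreover have "qpoch_inf (- q) q * (e / D * q ^ (M choose 2) / qpoch (- q) q (M + 0))
        + qpoch_inf (- q) q * (e * q ^ (2 * M + 2) / D * q ^ (M choose 2) / qpoch (- q) q (M + 2))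
        - qpoch_inf (- q) q * (e * q ^ (3 * M + 5) / D * q ^ (M choose 2) / qpoch (- q) q (M + 3))
      = qpoch_inf (- q) q * ?h j k"
    proof -
      have P: "qpoch (- q) q (M + 2) = qpoch (- q) q M * ((1 + q * q ^ M) * (1 + q\<^sup>2 * q ^ M))"
        "qpoch (- q) q (M + 3) = qpoch (- q) q M * ((1 + q * q ^ M) * (1 + q\<^sup>2 * q ^ M) * (1 + q ^ 3 * q ^ M))"
      proof -
        have "M + 2 = Suc (Suc M)" "M + 3 = Suc (Suc (Suc M))" by simp_all
        thus "qpoch (- q) q (M + 2) = qpoch (- q) q M * ((1 + q * q ^ M) * (1 + q\<^sup>2 * q ^ M))"
          "qpoch (- q) q (M + 3) = qpoch (- q) q M * ((1 + q * q ^ M) * (1 + q\<^sup>2 * q ^ M) * (1 + q ^ 3 * q ^ M))"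
          by (simp_all only: qpoch_Suc) (simp_all add: power2_eq_square power3_eq_cube mult_ac)
      qed
      have E: "pterm q 0 2 2 j k = e / D * q ^ (M choose 2) / qpoch (- q) q M"
        unfolding pterm_def M_def[symmetric] e_def D_def by (simp add: power_add mult_ac)
      have Q: "q ^ (2 * M + 2) = q\<^sup>2 * (q ^ M)\<^sup>2" "q ^ (3 * M + 5) = q ^ 5 * (q ^ M) ^ 3"
        by (simp_all only: power_add power_mult[symmetric] mult.commute[of _ M] mult.commute[of _ "q\<^sup>2"]
            mult.commute[of _ "q ^ 5"])
      have "c * (x / D * y / p) + c * (x * u / D * y / (p * f)) - c * (x * v / D * y / (p * g))
        = c * (x / D * y / p * (1 + u / f - v / g))" for c x y p u v f g :: complex
        by (simp only: divide_inverse inverse_mult_distrib algebra_simps mult_1_left mult_1_right)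
      thus ?thesis unfolding M_def[symmetric] E Q P add_0_right .
    qed
    ultimately show ?thesis by simp
  qed
  show "(\<lambda>n. \<Sum>j\<le>n. qpoch_inf (- q) q * ?h j (n - j)) sums (1 / (qpoch_inf (q^2) (q^3)
      * (qpoch_inf q (q^12) * qpoch_inf (q^6) (q^12) * qpoch_inf (q^9) (q^12))))"
    unfolding sum_distrib_left[symmetric] product_first[OF q(1), symmetric]
    by (rule sums_mult[OF diagonal_sum_first[OF q(1) summable_first_diagonal[OF q(1)] kummer_sum_first[OF q]]])
qed

text \<open>Only i = j = k = 0 has exponent 0, so the series reduces to one term equal to 1.\<close>

lemma has_sum_first_zero:
  "((\<lambda>(i::nat, j::nat, k::nat).
            (1 + 0 ^ (2*i + 4*j + 6*k + 2) - 0 ^ (3*i + 6*j + 9*k + 5))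
              * 0 ^ (((i + 2*j + 3*k) choose 2) + i + j^2 + 2*j + 2*k)
              / (qpoch 0 0 i * qpoch (0^2) (0^2) j * qpoch (0^3) (0^3) k))
          has_sum
            1 / (qpoch_inf (0^2) (0^3)
                  * (qpoch_inf 0 (0^12) * qpoch_inf (0^6) (0^12) * qpoch_inf (0^9) (0^12)))) UNIV"
    (is "(?f has_sum ?s) UNIV")
proof -
  have "?f (0, 0, 0) = ?s" by (simp add: binomial_eq_0)
  moreover have "(?f has_sum ?f (0, 0, 0)) {(0, 0, 0)}"
    using has_sum_finite[of "{(0, 0, 0)}" ?f]
    by (simp only: finite.emptyI finite.insertI sum.insert sum.empty empty_iff not_False_eq_True add_0_right)
  moreover have "?f x = 0" if "x \<noteq> (0, 0, 0)" for x
  proof -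
    obtain i j k where x: "x = (i, j, k)" by (cases x)
    have "((i + 2*j + 3*k) choose 2) + i + j^2 + 2*j + 2*k \<noteq> 0" using that x by auto
    thus ?thesis unfolding x by (simp only: prod.case power_0_left if_False mult_zero_right div_0)
  qed
  hence "(?f has_sum s) {(0, 0, 0)} \<longleftrightarrow> (?f has_sum s) UNIV" for s
    by (intro has_sum_cong_neutral) blast+
  ultimately show ?thesis by (simp only:)
qed

theorem theorem1p1:
  fixes q :: complex
  assumes "norm q < 1"
  shows "((\<lambda>(i::nat, j::nat, k::nat).
            (1 + q ^ (2*i + 4*j + 6*k + 2) - q ^ (3*i + 6*j + 9*k + 5))
              * q ^ (((i + 2*j + 3*k) choose 2) + i + j^2 + 2*j + 2*k)
              / (qpoch q q i * qpoch (q^2) (q^2) j * qpoch (q^3) (q^3) k))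
          has_sum
            1 / (qpoch_inf (q^2) (q^3)
                  * (qpoch_inf q (q^12) * qpoch_inf (q^6) (q^12) * qpoch_inf (q^9) (q^12)))) UNIV
       \<and> ((\<lambda>(i::nat, j::nat, k::nat).
            (1 + q + q ^ (2*j + 3*k + 2))
              * q ^ (((i + 2*j + 3*k) choose 2) + 3*i + j^2 + 4*j + 7*k)
              / (qpoch q q i * qpoch (q^2) (q^2) j * qpoch (q^3) (q^3) k))
          has_sum
            1 / (qpoch_inf q (q^3)
                  * (qpoch_inf (q^5) (q^12) * qpoch_inf (q^6) (q^12) * qpoch_inf (q^9) (q^12)))) UNIV"
proof (cases "q = 0")
  case True
  show ?thesis unfolding True by (rule conjI[OF has_sum_first_zero has_sum_second]) simp
next
  case False
  show ?thesis by (rule conjI[OF has_sum_first[OF assms False] has_sum_second[OF assms]])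
qed

end
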